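(* Let $2m$ be an integer, $a=\mathrm{diag}(im,-im)$, and $s_0(x,t)=e^{-2ax}$. Let $\pi$ be the Hermitian projection of $\mathbb{C}^2$ onto $\mathbb{C}\begin{pmatrix}1\\1\end{pmatrix}$, and for $1\le j\le 2k$ let $z_j=e^{i\theta_j}=\frac{r_j+i\mu_j}{m}$, $\mu_j=\sqrt{m^2-r_j^2}$, where $2r_1,\ldots,2r_{2k}$ are integers and $|r_j|<m$. Let $$s_{2k}=g_{z_{2k},\pi}\bullet(\cdots\bullet(g_{z_1,\pi}\bullet s_0)\cdots)$$ be the wave map obtained from $s_0$ (the wave map corresponding to the solution $(a,0,a)$ of the $-1$ flow equation) by applying the $2k$ Bäcklund transformations. If $z_{2j}=-\bar z_{2j-1}$, i.e. $r_{2j}=-r_{2j-1}$ and $\mu_{2j}=\mu_{2j-1}$, for all $1\le j\le k$, then $s_{2k}$ is a homoclinic $2k$-soliton wave map from $S^1\times\mathbb{R}^1$ into $S^2$.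
   Context: $S^2$ is identified with the totally geodesic $2$-sphere $\{y\in SU(2): y^t=y\}=\left\{\begin{pmatrix}z&is\\ is&\bar z\end{pmatrix}: z\in\mathbb{C},\ s\in\mathbb{R},\ |z|^2+s^2=1\right\}$ in $SU(2)=S^3$; a wave map into $SU(2)$ whose image lies in this sphere is a wave map into $S^2$. Coordinates: $\xi=\frac{x+t}{2}$, $\eta=\frac{x-t}{2}$. A wave map $s:\mathbb{R}^{1,1}\to SU(2)$ is a smooth map with $(s^{-1}s_t)_t=(s^{-1}s_x)_x$; if it is $2\pi$-periodic in $x$ it is a wave map from $S^1\times\mathbb{R}^1$. Such a periodic wave map is homoclinic if its limits as $t\to\infty$ and as $t\to-\infty$ (as functions of $x$) exist and coincide. The $-1$ flow equation associated to $SU(2)$, for $(a,u,v):\mathbb{R}^2\to su(2)^3$, is $a_\eta=0$, $u_\eta=[a,v]$, $v_\xi=-[u,v]$. The trivialization of a solution is the $E(\xi,\eta,\lambda)$, $\lambda\in\mathbb{C}\setminus\{0\}$, with $E_\xi=E(a\lambda+u)$, $E_\eta=\lambda^{-1}Ev$, $E(0,0,\lambda)=\mathrm{I}$; the wave map corresponding to $(a,u,v)$ is $s=E(\cdot,\cdot,-1)E(\cdot,\cdot,1)^{-1}$. For $(a,0,a)$ with $a$ constant, this is $e^{-2ax}$. Bäcklund transformation: for $z\in\mathbb{C}\setminus\mathbb{R}$ and $\pi$ the Hermitian projection onto a subspace $V\subset\mathbb{C}^2$, let $g_{z,\pi}(\lambda)=\pi+\frac{\lambda-z}{\lambda-\bar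 z}(\mathrm{I}-\pi)$. Given a solution $(a,u,v)$ with trivialization $E$, let $\tilde\pi(\xi,\eta)$ be the Hermitian projection onto $E(\xi,\eta,z)^*(V)$, $\tilde\pi^\perp=\mathrm{I}-\tilde\pi$. Then $g_{z,\pi}\bullet(a,u,v)=(a,\tilde u,\tilde v)$ with $\tilde u=u+(z-\bar z)[\tilde\pi,a]$, $\tilde v=\frac{1}{|z|^2}(\bar z\tilde\pi+z\tilde\pi^\perp)v(z\tilde\pi+\bar z\tilde\pi^\perp)$ is again a solution of the $-1$ flow equation on $\mathbb{R}^2$, with trivialization $\tilde E(\xi,\eta,\lambda)=g_{z,\pi}(\lambda)E(\xi,\eta,\lambda)g_{z,\tilde\pi(\xi,\eta)}(\lambda)^{-1}$ (extended holomorphically to $\lambda\in\mathbb{C}\setminus\{0\}$). If $s$ corresponds to $(a,u,v)$, then $g_{z,\pi}\bullet s$ denotes the wave map corresponding to $g_{z,\pi}\bullet(a,u,v)$. A wave map obtained from $s_0$ by $2k$ such transformations is called $2k$-soliton.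
   Formalization: The formal theorem also assumes that z_1,…,z_{2k} are pairwise distinct (so no r_j = 0); with a repeated pole, e.g. k=1, m=1/2, r_1=r_2=0, z_1=z_2=i, the map s_{2k} is not 2π-periodic in x and the claim fails. *)

theory Defs
  imports "HOL-Analysis.Analysis"
begin

type_synonym cmat = "complex^2^2"

section \<open>Matrices\<close>

definition mscale :: "complex \<Rightarrow> cmat \<Rightarrow> cmat" (infixr "\<cdot>\<^sub>M" 75) where
  "c \<cdot>\<^sub>M A = (\<chi> i j. c * A $ i $ j)"

definition adj :: "cmat \<Rightarrow> cmat" where
  "adj A = (\<chi> i j. cnj (A $ j $ i))"

definition bracket :: "cmat \<Rightarrow> cmat \<Rightarrow> cmat" where
  "bracket A B = A ** B - B ** A"

definition diag2 :: "complex \<Rightarrow> complex \<Rightarrow> cmat" where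
  "diag2 c d = vector [vector [c, 0], vector [0, d]]"

(* The library's exp does not apply here: it would need matrices to form a normed algebra. *)
definition mat_exp :: "cmat \<Rightarrow> cmat" where
  "mat_exp A = (\<Sum>n. (1 / fact n) *\<^sub>R (((**) A ^^ n) (mat 1)))"

definition su2 :: "cmat set" where
  "su2 = {A. adj A = - A \<and> trace A = 0}"

definition SU2 :: "cmat set" where
  "SU2 = {A. adj A ** A = mat 1 \<and> det A = 1}"

(* S^2 as a totally geodesic sphere in S^3 = SU(2). *)
definition S2 :: "cmat set" where
  "S2 = {A \<in> SU2. transpose A = A}"

definition hermitian_projection :: "cmat \<Rightarrow> bool" where
  "hermitian_projection p \<longleftrightarrow> p ** p = p \<and> adj p = p"

definition herm_proj :: "(complex^2) set \<Rightarrow> cmat" where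
  "herm_proj V = (THE p. hermitian_projection p \<and> range ((*v) p) = V)"

section \<open>Wave maps\<close>

(* C^n on the whole space. On a finite-dimensional domain, f is C^(n+1) iff it is
   differentiable and every directional derivative is C^n. *)
primrec Ck :: "nat \<Rightarrow> ('a::euclidean_space \<Rightarrow> 'b::real_normed_vector) \<Rightarrow> bool" where
  "Ck 0 f \<longleftrightarrow> continuous_on UNIV f"
| "Ck (Suc n) f \<longleftrightarrow>
     (\<exists>f'. (\<forall>p. (f has_derivative f' p) (at p)) \<and> (\<forall>v. Ck n (\<lambda>p. f' p v)))"

definition smooth2 :: "(real \<Rightarrow> real \<Rightarrow> cmat) \<Rightarrow> bool" where
  "smooth2 s \<longleftrightarrow> (\<forall>n. Ck n (\<lambda>(x, t). s x t))"

definition d1 :: "(real \<Rightarrow> real \<Rightarrow> cmat) \<Rightarrow> real \<Rightarrow> real \<Rightarrow> cmat" where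
  "d1 f x t = vector_derivative (\<lambda>x'. f x' t) (at x)"

definition d2 :: "(real \<Rightarrow> real \<Rightarrow> cmat) \<Rightarrow> real \<Rightarrow> real \<Rightarrow> cmat" where
  "d2 f x t = vector_derivative (\<lambda>t'. f x t') (at t)"

(* Maps on R^{1,1} take the arguments x, t in this order. *)
definition wave_map :: "(real \<Rightarrow> real \<Rightarrow> cmat) \<Rightarrow> bool" where
  "wave_map s \<longleftrightarrow> smooth2 s \<and> (\<forall>x t. s x t \<in> SU2) \<and>
     d2 (\<lambda>x t. matrix_inv (s x t) ** d2 s x t) = d1 (\<lambda>x t. matrix_inv (s x t) ** d1 s x t)"

definition periodic_wave_map :: "(real \<Rightarrow> real \<Rightarrow> cmat) \<Rightarrow> bool" where
  "periodic_wave_map s \<longleftrightarrow> wave_map s \<and> (\<forall>x t. s (x + 2 * pi) t = s x t)"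

definition homoclinic_wave_map :: "(real \<Rightarrow> real \<Rightarrow> cmat) \<Rightarrow> bool" where
  "homoclinic_wave_map s \<longleftrightarrow> periodic_wave_map s \<and>
     (\<exists>L. uniform_limit UNIV (\<lambda>t x. s x t) L at_top \<and>
          uniform_limit UNIV (\<lambda>t x. s x t) L at_bot)"

section \<open>The -1 flow\<close>

(* Triples (a, u, v) of functions of the light-cone coordinates xi = (x+t)/2, eta = (x-t)/2. *)
type_synonym flow =
  "(real \<Rightarrow> real \<Rightarrow> cmat) \<times> (real \<Rightarrow> real \<Rightarrow> cmat) \<times> (real \<Rightarrow> real \<Rightarrow> cmat)"

definition minus_one_flow :: "flow \<Rightarrow> bool" where
  "minus_one_flow S \<longleftrightarrow> (case S of (a, u, v) \<Rightarrow>
     (\<forall>\<xi> \<eta>. a \<xi> \<eta> \<in> su2 \<and> u \<xi> \<eta> \<in> su2 \<and> v \<xi> \<eta> \<in> su2 \<and>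
       ((\<lambda>y. a \<xi> y) has_vector_derivative 0) (at \<eta>) \<and>
       ((\<lambda>y. u \<xi> y) has_vector_derivative bracket (a \<xi> \<eta>) (v \<xi> \<eta>)) (at \<eta>) \<and>
       ((\<lambda>y. v y \<eta>) has_vector_derivative - bracket (u \<xi> \<eta>) (v \<xi> \<eta>)) (at \<xi>)))"

(* The spectral parameter lambda is l. Defined separately for each lambda \<noteq> 0 by the linear
   system at that lambda. For the
   Baecklund transform of a solution this is, also at lambda = z and lambda = cnj z, the
   holomorphic extension of g_{z,p}(lambda) E(xi, eta, lambda) g_{z,p~(xi,eta)}(lambda)^{-1}. *)
definition trivialization :: "flow \<Rightarrow> real \<Rightarrow> real \<Rightarrow> complex \<Rightarrow> cmat" where
  "trivialization S \<xi> \<eta> l = ((case S of (a, u, v) \<Rightarrow>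
     (THE E. E 0 0 = mat 1 \<and>
       (\<forall>\<xi> \<eta>.
         ((\<lambda>y. E y \<eta>) has_vector_derivative E \<xi> \<eta> ** (l \<cdot>\<^sub>M a \<xi> \<eta> + u \<xi> \<eta>)) (at \<xi>) \<and>
         ((\<lambda>y. E \<xi> y) has_vector_derivative inverse l \<cdot>\<^sub>M (E \<xi> \<eta> ** v \<xi> \<eta>)) (at \<eta>))))) \<xi> \<eta>"

definition flow_wave_map :: "flow \<Rightarrow> real \<Rightarrow> real \<Rightarrow> cmat" where
  "flow_wave_map S x t =
     (let E = trivialization S ((x + t) / 2) ((x - t) / 2) in E (-1) ** matrix_inv (E 1))"

definition corresponds :: "flow \<Rightarrow> (real \<Rightarrow> real \<Rightarrow> cmat) \<Rightarrow> bool" where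
  "corresponds S s \<longleftrightarrow> minus_one_flow S \<and> s = flow_wave_map S"

definition vacuum :: "cmat \<Rightarrow> flow" where
  "vacuum a = ((\<lambda>_ _. a), (\<lambda>_ _. 0), (\<lambda>_ _. a))"

(* g_{z,p} \<bullet> (a, u, v); the subspace V is recovered as the range of p. *)
definition backlund :: "complex \<Rightarrow> cmat \<Rightarrow> flow \<Rightarrow> flow" where
  "backlund z p S = (case S of (a, u, v) \<Rightarrow>
     let q = (\<lambda>\<xi> \<eta>. herm_proj ((*v) (adj (trivialization S \<xi> \<eta> z)) ` range ((*v) p)));
         q' = (\<lambda>\<xi> \<eta>. mat 1 - q \<xi> \<eta>)
     in (a,
         (\<lambda>\<xi> \<eta>. u \<xi> \<eta> + (z - cnj z) \<cdot>\<^sub>M bracket (q \<xi> \<eta>) (a \<xi> \<eta>)),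
         (\<lambda>\<xi> \<eta>. complex_of_real (1 / (cmod z)\<^sup>2) \<cdot>\<^sub>M
            ((cnj z \<cdot>\<^sub>M q \<xi> \<eta> + z \<cdot>\<^sub>M q' \<xi> \<eta>) ** v \<xi> \<eta> ** (z \<cdot>\<^sub>M q \<xi> \<eta> + cnj z \<cdot>\<^sub>M q' \<xi> \<eta>)))))"

primrec backlund_seq :: "(nat \<Rightarrow> complex) \<Rightarrow> (nat \<Rightarrow> cmat) \<Rightarrow> flow \<Rightarrow> nat \<Rightarrow> flow" where
  "backlund_seq z p S 0 = S"
| "backlund_seq z p S (Suc n) = backlund (z (Suc n)) (p (Suc n)) (backlund_seq z p S n)"

(* s is an n-soliton obtained from the seed s0 corresponding to the solution S0. *)
definition soliton_wave_map ::
  "flow \<Rightarrow> (real \<Rightarrow> real \<Rightarrow> cmat) \<Rightarrow> nat \<Rightarrow> (real \<Rightarrow> real \<Rightarrow> cmat) \<Rightarrow> bool" where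
  "soliton_wave_map S0 s0 n s \<longleftrightarrow> corresponds S0 s0 \<and> wave_map s \<and>
     (\<exists>z p. (\<forall>j\<in>{1..n}. z j \<notin> \<real> \<and> hermitian_projection (p j)) \<and>
            corresponds (backlund_seq z p S0 n) s)"

end

theory Submission
  imports Defs
begin

text \<open>Each Baecklund transformation multiplies the frame \<open>E(\<lambda>)\<close> of the linear system by a constant
  simple factor on the left and by a space-time dependent simple factor on the right. All \<open>z\<^sub>j\<close> lie in
  the open upper half plane and are distinct, so no factor is ever evaluated at its pole, and the
  frame of \<open>s\<^sub>2\<^sub>k\<close> is \<open>C(\<lambda>) E\<^sub>0(\<lambda>) H(\<lambda>)\<close> with \<open>E\<^sub>0(\<lambda>) = exp (a (\<lambda> \<xi> + \<eta> / \<lambda>))\<close>. Here \<open>H\<close> depends on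
  space-time only through the Hermitian matrices \<open>P\<^sub>j = E\<^sub>0(z\<^sub>j)\<^sup>* \<pi> E\<^sub>0(z\<^sub>j)\<close>, whose entries are
  multiples of \<open>exp (\<plusminus>2 \<mu>\<^sub>j t)\<close> and \<open>exp (\<plusminus>2 i r\<^sub>j x)\<close>. This gives periodicity in \<open>x\<close>; moreover the
  normalised \<open>P\<^sub>j\<close> tends to a coordinate projection as \<open>t \<rightarrow> \<plusminus>\<infinity>\<close>, uniformly in \<open>x\<close>, so that
  \<open>H(-1) H(1)\<^sup>-\<^sup>1\<close> tends to the identity at both ends: the Blaschke factors of a pair \<open>z, - cnj z\<close> on the
  unit circle multiply to \<open>-1\<close> at \<open>\<lambda> = \<plusminus>1\<close>. Finally, for such a pair the product of the two right factors
  satisfies \<open>h(-\<lambda>)\<^sup>t h(\<lambda>) = 1\<close>, whence \<open>s = E(-1) E(-1)\<^sup>t\<close> is symmetric.\<close>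

section \<open>Entrywise algebra of 2 by 2 complex matrices\<close>

lemma cmat_eq_iff:
  fixes A B :: cmat
  shows "A = B \<longleftrightarrow> A$1$1 = B$1$1 \<and> A$1$2 = B$1$2 \<and> A$2$1 = B$2$1 \<and> A$2$2 = B$2$2"
  by (auto simp: vec_eq_iff forall_2)

lemma mult_nth: "((A::cmat) ** B) $ i $ j = A$i$1 * B$1$j + A$i$2 * B$2$j"
  by (simp add: matrix_matrix_mult_def sum_2)

lemma mscale_nth [simp]: "(c \<cdot>\<^sub>M A) $ i $ j = c * A $ i $ j"
  by (simp add: mscale_def)

lemma adj_nth [simp]: "adj A $ i $ j = cnj (A $ j $ i)"
  by (simp add: adj_def)

lemma mat_nth: "(mat c :: cmat) $ i $ j = (if i = j then c else 0)"
  by (simp add: mat_def)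

lemma transpose_nth [simp]: "transpose (A::cmat) $ i $ j = A $ j $ i"
  by (simp add: transpose_def)

lemma diag2_nth [simp]:
  "diag2 c d $ 1 $ 1 = c" "diag2 c d $ 1 $ 2 = 0" "diag2 c d $ 2 $ 1 = 0" "diag2 c d $ 2 $ 2 = d"
  by (simp_all add: diag2_def vector_2)

lemma trace_2: "trace (A::cmat) = A$1$1 + A$2$2"
  by (simp add: trace_def sum_2)

lemmas cmat_simps = cmat_eq_iff mult_nth mat_nth trace_2 det_2

lemma mult_simps:
  fixes A B C :: cmat
  shows "(A + B) ** C = A ** C + B ** C" "A ** (B + C) = A ** B + A ** C"
    "(A - B) ** C = A ** C - B ** C" "A ** (B - C) = A ** B - A ** C"
    "(- A) ** B = - (A ** B)" "A ** (- B) = - (A ** B)"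
    "(c \<cdot>\<^sub>M A) ** B = c \<cdot>\<^sub>M (A ** B)" "A ** (c \<cdot>\<^sub>M B) = c \<cdot>\<^sub>M (A ** B)"
    "A ** (B ** C) = A ** B ** C" "0 ** A = 0" "A ** 0 = 0"
  by (simp_all add: matrix_add_ldistrib matrix_mul_assoc)
     (simp_all add: cmat_simps algebra_simps)

lemma mscale_simps:
  "c \<cdot>\<^sub>M (A + B) = c \<cdot>\<^sub>M A + c \<cdot>\<^sub>M B" "c \<cdot>\<^sub>M (A - B) = c \<cdot>\<^sub>M A - c \<cdot>\<^sub>M B"
  "c \<cdot>\<^sub>M (- A) = - (c \<cdot>\<^sub>M A)" "c \<cdot>\<^sub>M (d \<cdot>\<^sub>M A) = (c * d) \<cdot>\<^sub>M A" "c \<cdot>\<^sub>M 0 = 0"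
  "1 \<cdot>\<^sub>M A = A" "0 \<cdot>\<^sub>M A = 0"
  by (simp_all add: cmat_simps algebra_simps)

lemma trace_mscale: "trace (c \<cdot>\<^sub>M A) = c * trace A"
  by (simp add: trace_2 algebra_simps)

lemma adj_simps:
  "adj (A + B) = adj A + adj B" "adj (A - B) = adj A - adj B" "adj (- A) = - adj A"
  "adj (c \<cdot>\<^sub>M A) = cnj c \<cdot>\<^sub>M adj A" "adj (A ** B) = adj B ** adj A" "adj (mat 1) = mat 1"
  "adj (adj A) = A" "adj 0 = 0"
  by (simp_all add: cmat_simps algebra_simps)

lemma det_adj: "det (adj A) = cnj (det A)"
  by (simp add: cmat_simps)

text \<open>Bilinearity suffices because the spaces are finite-dimensional. Boundedness then
  supplies the Leibniz rule, the continuity of products and the estimates behind the uniform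
  limits.\<close>

lemma bounded_bilinear_matrix_mult: "bounded_bilinear ((**) :: cmat \<Rightarrow> cmat \<Rightarrow> cmat)"
proof -
  have "bilinear ((**) :: cmat \<Rightarrow> cmat \<Rightarrow> cmat)"
    unfolding bilinear_def
    by (auto intro!: linearI simp: cmat_simps algebra_simps)
  then show ?thesis by (simp add: bilinear_conv_bounded_bilinear)
qed

lemma bounded_bilinear_mscale: "bounded_bilinear (\<cdot>\<^sub>M)"
proof -
  have "bilinear (\<cdot>\<^sub>M)"
    unfolding bilinear_def
    by (auto intro!: linearI simp: cmat_simps algebra_simps)
  then show ?thesis by (simp add: bilinear_conv_bounded_bilinear)
qed

lemma bounded_linear_adj: "bounded_linear adj"
proof -
  have "linear adj"
    by (auto intro!: linearI simp: cmat_simps algebra_simps)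
  then show ?thesis by (simp add: linear_conv_bounded_linear)
qed

lemma bounded_linear_trace: "bounded_linear (trace :: cmat \<Rightarrow> complex)"
proof -
  have "linear (trace :: cmat \<Rightarrow> complex)"
    by (auto intro!: linearI simp: cmat_simps algebra_simps)
  then show ?thesis by (simp add: linear_conv_bounded_linear)
qed

lemma bounded_linear_diag2: "bounded_linear (\<lambda>c. diag2 c 0)" "bounded_linear (\<lambda>d. diag2 0 d)"
proof -
  have "linear (\<lambda>c. diag2 c 0)" "linear (\<lambda>d. diag2 0 d)"
    by (auto intro!: linearI simp: cmat_simps algebra_simps)
  then show "bounded_linear (\<lambda>c. diag2 c 0)" "bounded_linear (\<lambda>d. diag2 0 d)"
    by (simp_all add: linear_conv_bounded_linear)
qed

lemmas mult_has_vector_derivative = bounded_bilinear.has_vector_derivative[OF bounded_bilinear_matrix_mult]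
lemmas mscale_has_vector_derivative = bounded_bilinear.has_vector_derivative[OF bounded_bilinear_mscale]
lemmas adj_has_vector_derivative = bounded_linear.has_vector_derivative[OF bounded_linear_adj]
lemmas trace_has_vector_derivative = bounded_linear.has_vector_derivative[OF bounded_linear_trace]

section \<open>Smooth functions\<close>

lemma Ck_SucI:
  assumes "\<And>p. (f has_derivative f' p) (at p)" "\<And>v. Ck n (\<lambda>p. f' p v)"
  shows "Ck (Suc n) f"
  using assms by (auto intro: exI[of _ f'])

lemma Ck_SucE:
  assumes "Ck (Suc n) f"
  obtains f' where "\<And>p. (f has_derivative f' p) (at p)" "\<And>v. Ck n (\<lambda>p. f' p v)"
  using assms by auto

text \<open>Lets the undifferentiated factor in the Leibniz rule be used one order lower.
  Differentiability gives continuity at order 0; the step applies the induction hypothesis to the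
  directional derivatives.\<close>

lemma Ck_SucD: "Ck (Suc n) f \<Longrightarrow> Ck n f"
proof (induction n arbitrary: f)
  case 0
  then obtain f' where "\<And>p. (f has_derivative f' p) (at p)"
    "\<And>v. Ck 0 (\<lambda>p. f' p v)" by (rule Ck_SucE) blast
  then have "continuous (at p) f" for p by (meson has_derivative_continuous)
  then show ?case by (simp add: continuous_at_imp_continuous_on)
next
  case (Suc n)
  from Suc.prems obtain f' where f': "\<And>p. (f has_derivative f' p) (at p)" "\<And>v. Ck (Suc n) (\<lambda>p. f' p v)"
    by (rule Ck_SucE) blast
  show ?case by (rule Ck_SucI[OF f'(1) Suc.IH[OF f'(2)]])
qed

lemma Ck_const: "Ck n (\<lambda>p. c)"
proof (induction n arbitrary: c)
  case (Suc n)
  show ?case by (rule Ck_SucI[OF has_derivative_const Suc])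
qed simp

lemma Ck_ident: "Ck n (\<lambda>p. p)"
proof (cases n)
  case (Suc m)
  show ?thesis unfolding Suc by (rule Ck_SucI[OF has_derivative_ident Ck_const])
qed simp

lemma Ck_bounded_linear:
  assumes L: "bounded_linear L"
  shows "Ck n f \<Longrightarrow> Ck n (\<lambda>p. L (f p))"
proof (induction n arbitrary: f)
  case 0
  then show ?case by (simp add: bounded_linear.continuous_on[OF L])
next
  case (Suc n)
  from Suc.prems obtain f' where f': "\<And>p. (f has_derivative f' p) (at p)" "\<And>v. Ck n (\<lambda>p. f' p v)"
    by (rule Ck_SucE) blast
  show ?case
    by (rule Ck_SucI[OF bounded_linear.has_derivative[OF L f'(1)] Suc.IH[OF f'(2)]])
qed

lemma Ck_add: "Ck n f \<Longrightarrow> Ck n g \<Longrightarrow> Ck n (\<lambda>p. f p + g p)"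
proof (induction n arbitrary: f g)
  case 0
  then show ?case by (simp add: continuous_on_add)
next
  case (Suc n)
  from Suc.prems(1) obtain f' where f': "\<And>p. (f has_derivative f' p) (at p)" "\<And>v. Ck n (\<lambda>p. f' p v)"
    by (rule Ck_SucE) blast
  from Suc.prems(2) obtain g' where g': "\<And>p. (g has_derivative g' p) (at p)" "\<And>v. Ck n (\<lambda>p. g' p v)"
    by (rule Ck_SucE) blast
  show ?case
    by (rule Ck_SucI[OF has_derivative_add[OF f'(1) g'(1)] Suc.IH[OF f'(2) g'(2)]])
qed

lemma Ck_bounded_bilinear:
  assumes B: "bounded_bilinear B"
  shows "Ck n f \<Longrightarrow> Ck n g \<Longrightarrow> Ck n (\<lambda>p. B (f p) (g p))"
proof (induction n arbitrary: f g)
  case 0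
  then show ?case by (simp add: bounded_bilinear.continuous_on[OF B])
next
  case (Suc n)
  from Suc.prems(1) obtain f' where f': "\<And>p. (f has_derivative f' p) (at p)" "\<And>v. Ck n (\<lambda>p. f' p v)"
    by (rule Ck_SucE) blast
  from Suc.prems(2) obtain g' where g': "\<And>p. (g has_derivative g' p) (at p)" "\<And>v. Ck n (\<lambda>p. g' p v)"
    by (rule Ck_SucE) blast
  have fg: "Ck n f" "Ck n g" using Suc.prems by (simp_all only: Ck_SucD)
  show ?case
    by (rule Ck_SucI[OF bounded_bilinear.FDERIV[OF B f'(1) g'(1)]
          Ck_add[OF Suc.IH[OF fg(1) g'(2)] Suc.IH[OF f'(2) fg(2)]]])
qed

text \<open>The derivative of 1/f is again built from 1/f and f', so the induction hypothesis for
  1/f itself and closure under products suffice. The exponential follows the same pattern.\<close>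

lemma Ck_inverse:
  fixes f :: "'a::euclidean_space \<Rightarrow> 'b::real_normed_field"
  assumes "\<And>p. f p \<noteq> 0"
  shows "Ck n f \<Longrightarrow> Ck n (\<lambda>p. inverse (f p))"
proof (induction n)
  case 0
  then show ?case using assms by (simp add: continuous_on_inverse)
next
  case (Suc n)
  from Suc.prems obtain f' where f': "\<And>p. (f has_derivative f' p) (at p)" "\<And>v. Ck n (\<lambda>p. f' p v)"
    by (rule Ck_SucE) blast
  have "Ck n (\<lambda>p. inverse (f p))" using Suc Ck_SucD[of n f] by simp
  then have C: "Ck n (\<lambda>p. - (inverse (f p) * f' p v * inverse (f p)))" for v
    using f'(2) by (intro Ck_bounded_linear[OF bounded_linear_minus[OF bounded_linear_ident]]
      Ck_bounded_bilinear[OF bounded_bilinear_mult])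
  show ?case
    by (rule Ck_SucI[OF Deriv.has_derivative_inverse[OF assms f'(1)] C])
qed

lemma Ck_exp:
  fixes f :: "'a::euclidean_space \<Rightarrow> complex"
  shows "Ck n f \<Longrightarrow> Ck n (\<lambda>p. exp (f p))"
proof (induction n)
  case 0
  then show ?case by (simp add: continuous_on_exp)
next
  case (Suc n)
  from Suc.prems obtain f' where f': "\<And>p. (f has_derivative f' p) (at p)" "\<And>v. Ck n (\<lambda>p. f' p v)"
    by (rule Ck_SucE) blast
  have "Ck n (\<lambda>p. exp (f p))" using Suc Ck_SucD[of n f] by simp
  then have C: "Ck n (\<lambda>p. exp (f p) * f' p v)" for v
    using f'(2) by (intro Ck_bounded_bilinear[OF bounded_bilinear_mult])
  have "((\<lambda>p. exp (f p)) has_derivative (\<lambda>v. exp (f p) * f' p v)) (at p)" for p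
    by (rule has_derivative_compose[OF f'(1)]) (use DERIV_exp[of "f p"] in \<open>simp add: has_field_derivative_def\<close>)
  from Ck_SucI[OF this C] show ?case .
qed

lemma Ck_compose_linear:
  assumes L: "bounded_linear L"
  shows "Ck n f \<Longrightarrow> Ck n (\<lambda>p. f (L p))"
proof (induction n arbitrary: f)
  case 0
  then show ?case
    using continuous_on_compose2[OF _ linear_continuous_on[OF L], of UNIV f UNIV] by simp
next
  case (Suc n)
  from Suc.prems obtain f' where f': "\<And>p. (f has_derivative f' p) (at p)" "\<And>v. Ck n (\<lambda>p. f' p v)"
    by (rule Ck_SucE) blast
  show ?case
    by (rule Ck_SucI[OF has_derivative_compose[OF bounded_linear_imp_has_derivative[OF L] f'(1)] Suc.IH[OF f'(2)]])
qed

section \<open>Rank one projections\<close>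

text \<open>The trace of a projection is its rank, so projections onto lines are singled out by
  equations between entries, without subspaces.\<close>

definition rank_one_projection :: "cmat \<Rightarrow> bool" where
  "rank_one_projection p \<longleftrightarrow> hermitian_projection p \<and> trace p = 1"

text \<open>For Hermitian \<open>N\<close> of rank one this is the Hermitian projection onto the
  range of \<open>N\<close>. A moving line can thus be followed through \<open>N\<close>, without
  choosing a spanning vector.\<close>

definition normalize_trace :: "cmat \<Rightarrow> cmat" where
  "normalize_trace N = inverse (trace N) \<cdot>\<^sub>M N"

text \<open>The determinant vanishes by Cayley-Hamilton: with trace 1 and \<open>p ** p = p\<close>
  only the term \<open>det p\<close> times the identity is left.\<close>

lemma rank_one_projectionD:
  assumes "rank_one_projection p"
  shows "p ** p = p" "adj p = p" "trace p = 1" "det p = 0"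
proof -
  show p: "p ** p = p" and "adj p = p" and t: "trace p = 1"
    using assms by (auto simp: rank_one_projection_def hermitian_projection_def)
  have "p ** p = trace p \<cdot>\<^sub>M p - det p \<cdot>\<^sub>M mat 1"
    by (simp add: cmat_simps algebra_simps)
  then have "det p \<cdot>\<^sub>M mat 1 = (0 :: cmat)" using p t by (simp add: mscale_simps)
  then show "det p = 0" by (simp add: cmat_eq_iff mat_nth)
qed

lemma idem_mult:
  fixes p X :: cmat
  assumes "p ** p = p"
  shows "X ** p ** p = X ** p"
  using assms by (simp add: matrix_mul_assoc[symmetric])

text \<open>By Cayley-Hamilton \<open>N ** N\<close> is \<open>trace N\<close> times
  \<open>N\<close>, so division by the trace gives an idempotent. It stays Hermitian because the
  trace of a Hermitian matrix is real.\<close>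

lemma rank_one_normalize_trace:
  assumes N: "adj N = N" "det N = 0" "trace N \<noteq> 0"
  shows "rank_one_projection (normalize_trace N)"
proof -
  have "N ** N = trace N \<cdot>\<^sub>M N - det N \<cdot>\<^sub>M mat 1"
    by (simp add: cmat_simps algebra_simps)
  then have NN: "N ** N = trace N \<cdot>\<^sub>M N" using N by (simp add: mscale_simps)
  have "cnj (trace N) = trace (adj N)" by (simp add: trace_2)
  then have T: "cnj (trace N) = trace N" using N by simp
  have "trace (normalize_trace N) = inverse (trace N) * trace N"
    by (simp add: normalize_trace_def trace_2 algebra_simps)
  then show ?thesis
    using N NN T unfolding rank_one_projection_def hermitian_projection_def
    by (simp add: normalize_trace_def mult_simps mscale_simps adj_simps)
qed

text \<open>A matrix of determinant 0 is a column times a row, so the row, \<open>X\<close> and the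
  column between the two outer copies collapse to a scalar, which is the trace.\<close>

lemma rank_one_sandwich:
  assumes "det q = 0"
  shows "q ** X ** q = trace (X ** q) \<cdot>\<^sub>M q"
proof -
  have d: "q$1$1 * q$2$2 = q$1$2 * q$2$1" using assms by (simp add: det_2)
  show ?thesis unfolding cmat_simps mscale_nth
    using d by (intro conjI; algebra)
qed

lemma normalize_trace_scale:
  assumes "c \<noteq> 0"
  shows "normalize_trace (c \<cdot>\<^sub>M N) = normalize_trace N"
proof -
  have "trace (c \<cdot>\<^sub>M N) = c * trace N" by (simp add: trace_2 algebra_simps)
  moreover have "inverse (c * trace N) * c = inverse (trace N)" using assms by simp
  ultimately show ?thesis by (simp only: normalize_trace_def mscale_simps(4))
qed

lemma normalize_trace_projection: "trace p = 1 \<Longrightarrow> normalize_trace p = p"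
  by (simp add: normalize_trace_def mscale_simps)

text \<open>The hypothesis is what \<open>N = adj E ** p ** E\<close> satisfies when E' = E A. The
  quotient rule subtracts multiples of \<open>q\<close> by traces, and
  \<open>rank_one_sandwich\<close> turns these into the words \<open>q ** A ** q\<close> and
  \<open>q ** adj A ** q\<close>.\<close>

lemma normalize_trace_has_vector_derivative:
  assumes N': "(N has_vector_derivative adj A ** N t + N t ** A) (at t)"
    and N: "det (N t) = 0" "trace (N t) \<noteq> 0"
  defines "q \<equiv> normalize_trace (N t)"
  shows "((\<lambda>t. normalize_trace (N t)) has_vector_derivative
    q ** A ** (mat 1 - q) + (mat 1 - q) ** adj A ** q) (at t)"
proof -
  define T where "T = trace (N t)"
  have T: "T \<noteq> 0" using N by (simp add: T_def)
  have Nq: "N t = T \<cdot>\<^sub>M q" using T by (simp add: q_def T_def normalize_trace_def mscale_simps)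
  have "T * T * det q = 0" using N unfolding Nq by (simp add: det_2 algebra_simps)
  then have dq: "det q = 0" using T by simp
  let ?M = "adj A ** q + q ** A"
  have tr: "((\<lambda>t. trace (N t)) has_vector_derivative T * trace ?M) (at t)"
    by (rule has_vector_derivative_eq_rhs[OF trace_has_vector_derivative[OF N']])
       (simp add: Nq mult_simps trace_2 algebra_simps)
  have inv: "((\<lambda>t. inverse (trace (N t))) has_vector_derivative (T * trace ?M) * - (inverse T * inverse T)) (at t)"
    using field_vector_diff_chain_at[OF tr DERIV_inverse[OF N(2)]]
    by (simp add: o_def T_def power2_eq_square)
  have "((\<lambda>t. inverse (trace (N t)) \<cdot>\<^sub>M N t) has_vector_derivative
     inverse T \<cdot>\<^sub>M (adj A ** N t + N t ** A) + ((T * trace ?M) * - (inverse T * inverse T)) \<cdot>\<^sub>M N t) (at t)"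
    using mscale_has_vector_derivative[OF inv N'] by (simp add: T_def)
  moreover have "q ** A ** (mat 1 - q) + (mat 1 - q) ** adj A ** q =
      ?M - trace (A ** q) \<cdot>\<^sub>M q - trace (adj A ** q) \<cdot>\<^sub>M q"
    using rank_one_sandwich[OF dq] by (simp add: mult_simps)
  moreover have "inverse T \<cdot>\<^sub>M (adj A ** N t + N t ** A) + ((T * trace ?M) * - (inverse T * inverse T)) \<cdot>\<^sub>M N t
     = ?M - trace (A ** q) \<cdot>\<^sub>M q - trace (adj A ** q) \<cdot>\<^sub>M q"
    using T unfolding Nq by (simp add: mult_simps mscale_simps) (simp add: cmat_simps field_simps)
  ultimately show ?thesis by (simp add: normalize_trace_def)
qed

text \<open>Uniqueness: Hermitian projections with the same range absorb each other,
  \<open>p ** q = q\<close> and \<open>q ** p = p\<close>, and the adjoint of the first product is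
  the second.\<close>

lemma herm_proj_eq:
  assumes "hermitian_projection p" "range ((*v) p) = V"
  shows "herm_proj V = p"
  unfolding herm_proj_def
proof (rule the_equality)
  show "hermitian_projection p \<and> range ((*v) p) = V" using assms by simp
next
  have absorb: "p ** q = q"
    if herm: "hermitian_projection p" and range: "range ((*v) q) \<subseteq> range ((*v) p)" for p q
  proof -
    have "p *v (q *v x) = q *v x" for x
    proof -
      obtain y where "q *v x = p *v y" using range by blast
      then show ?thesis
        using herm by (simp add: matrix_vector_mul_assoc hermitian_projection_def)
    qed
    then show ?thesis by (simp add: matrix_eq matrix_vector_mul_assoc)
  qed
  fix q assume q: "hermitian_projection q \<and> range ((*v) q) = V"
  then have pq: "p ** q = q" "q ** p = p" using absorb[of p q] absorb[of q p] assms by auto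
  have "adj (p ** q) = q ** p" using assms q by (simp add: adj_simps hermitian_projection_def)
  then show "q = p" using pq q by (simp add: hermitian_projection_def)
qed

text \<open>The trace is the sum of the squared moduli of all entries.\<close>

lemma adj_mult_self_nonzero:
  fixes X :: cmat
  assumes "X \<noteq> 0"
  shows "trace (adj X ** X) \<noteq> 0"
proof -
  have "trace (adj X ** X) = of_real ((cmod (X$1$1))\<^sup>2 + (cmod (X$2$1))\<^sup>2 + (cmod (X$1$2))\<^sup>2 + (cmod (X$2$2))\<^sup>2)"
    unfolding trace_2 mult_nth adj_nth of_real_add complex_norm_square
    by (simp add: ac_simps)
  moreover have "(cmod (X$1$1))\<^sup>2 + (cmod (X$2$1))\<^sup>2 + (cmod (X$1$2))\<^sup>2 + (cmod (X$2$2))\<^sup>2 \<noteq> 0"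
    using assms by (auto simp: cmat_eq_iff add_nonneg_eq_0_iff)
  ultimately show ?thesis by (metis of_real_eq_0_iff)
qed

text \<open>Identifies the projection in the Baecklund transformation with a normalised matrix. The
  trace is nonzero because \<open>N\<close> is \<open>adj X ** X\<close> for the nonzero
  \<open>X = p ** E\<close>; the ranges agree because \<open>E\<close> is invertible.\<close>

lemma pullback_projection:
  assumes p: "rank_one_projection p" and E: "F ** E = mat 1"
  defines "N \<equiv> adj E ** p ** E"
  shows "adj N = N" "det N = 0" "trace N \<noteq> 0" "rank_one_projection (normalize_trace N)"
    "herm_proj ((*v) (adj E) ` range ((*v) p)) = normalize_trace N"
proof -
  note pD = rank_one_projectionD[OF p]
  have EF: "E ** F = mat 1" using E by (simp add: matrix_left_right_inverse)
  show N1: "adj N = N" by (simp add: N_def adj_simps pD matrix_mul_assoc)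
  show N2: "det N = 0" by (simp add: N_def det_mul pD)
  have "p ** E \<noteq> 0"
  proof
    assume "p ** E = 0"
    then have "p ** E ** F = 0" by (simp add: mult_simps)
    then have "p = 0" using EF by (simp add: matrix_mul_assoc[symmetric])
    then show False using pD(3) by (simp add: trace_2)
  qed
  moreover have "N = adj (p ** E) ** (p ** E)"
    by (simp add: N_def adj_simps pD mult_simps idem_mult)
  ultimately show N3: "trace N \<noteq> 0" using adj_mult_self_nonzero by simp
  show r: "rank_one_projection (normalize_trace N)" using N1 N2 N3 by (rule rank_one_normalize_trace)
  show "herm_proj ((*v) (adj E) ` range ((*v) p)) = normalize_trace N"
  proof (rule herm_proj_eq)
    show "hermitian_projection (normalize_trace N)" using r by (simp add: rank_one_projection_def)
    have sc: "(c \<cdot>\<^sub>M A) *v x = A *v (c *s x)" for c A and x :: "complex^2"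
      by (simp add: vec_eq_iff matrix_vector_mult_def sum_2 algebra_simps)
    \<comment> \<open>Surjectivity of \<open>E\<close>, also after scaling: neither the inner factor
      \<open>E\<close> nor the division by the trace shrinks the range.\<close>
    have sj: "\<exists>y. x = E *v (c *s y)" if "c \<noteq> 0" for c x
    proof
      show "x = E *v (c *s (inverse c *s (F *v x)))"
        using that EF by (simp add: matrix_vector_mul_assoc)
    qed
    show "range ((*v) (normalize_trace N)) = (*v) (adj E) ` range ((*v) p)"
    proof (intro set_eqI iffI)
      fix y assume "y \<in> range ((*v) (normalize_trace N))"
      then obtain x where "y = normalize_trace N *v x" by auto
      then have "y = adj E *v (p *v (E *v (inverse (trace N) *s x)))"
        by (simp add: normalize_trace_def sc N_def matrix_vector_mul_assoc matrix_mul_assoc)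
      then show "y \<in> (*v) (adj E) ` range ((*v) p)" by auto
    next
      fix y assume "y \<in> (*v) (adj E) ` range ((*v) p)"
      then obtain x where x: "y = adj E *v (p *v x)" by auto
      obtain x' where "x = E *v (inverse (trace N) *s x')" using sj N3 by (metis inverse_nonzero_iff_nonzero)
      with x have "y = normalize_trace N *v x'"
        by (simp add: normalize_trace_def sc N_def matrix_vector_mul_assoc matrix_mul_assoc)
      then show "y \<in> range ((*v) (normalize_trace N))" by auto
    qed
  qed
qed

section \<open>Simple factors\<close>

text \<open>\<open>simple_factor p (blaschke z l)\<close> is the factor g of the Baecklund
  transformation. With the scalar as a separate argument, products, inverses and adjoints for a
  fixed projection become operations on scalars.\<close>

definition simple_factor :: "cmat \<Rightarrow> complex \<Rightarrow> cmat" where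
  "simple_factor p c = p + c \<cdot>\<^sub>M (mat 1 - p)"

definition blaschke :: "complex \<Rightarrow> complex \<Rightarrow> complex" where
  "blaschke z l = (l - z) / (l - cnj z)"

lemma simple_factor_mult:
  assumes "p ** p = p"
  shows "simple_factor p c ** simple_factor p d = simple_factor p (c * d)"
  by (simp add: simple_factor_def mult_simps mscale_simps assms mult.commute)

lemma simple_factor_1 [simp]: "simple_factor p 1 = mat 1"
  by (simp add: simple_factor_def mscale_simps)

lemma simple_factor_adj: "adj p = p \<Longrightarrow> adj (simple_factor p c) = simple_factor p (cnj c)"
  by (simp add: simple_factor_def adj_simps)

lemma simple_factor_det:
  assumes "trace p = 1" "det p = 0"
  shows "det (simple_factor p c) = c"
proof -
  have "p$1$1 * p$2$2 = p$1$2 * p$2$1" "p$2$2 = 1 - p$1$1"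
    using assms by (simp_all add: det_2 trace_2 algebra_simps)
  then show ?thesis
    unfolding simple_factor_def by (simp add: det_2 mat_nth) algebra
qed

lemma simple_factor_absorb:
  assumes "p ** p = p"
  shows "p ** simple_factor p c = p" "simple_factor p c ** p = p"
  using assms by (simp_all add: simple_factor_def mult_simps mscale_simps)

lemma blaschke_cnj: "cnj (blaschke z l) = blaschke (cnj z) (cnj l)"
  by (simp add: blaschke_def)

text \<open>Hence passing from \<open>z\<close> to \<open>cnj z\<close> inverts a simple factor;
  this is why the factors multiplied on the right carry \<open>cnj z\<close>.\<close>

lemma blaschke_inverse:
  "l \<noteq> z \<Longrightarrow> l \<noteq> cnj z \<Longrightarrow> blaschke z l * blaschke (cnj z) l = 1"
  by (simp add: blaschke_def)

lemma simple_factor_has_vector_derivative: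
  assumes "(q has_vector_derivative q') (at t)"
  shows "((\<lambda>t. simple_factor (q t) c) has_vector_derivative (1 - c) \<cdot>\<^sub>M q') (at t)"
proof -
  have "((\<lambda>t. c \<cdot>\<^sub>M (mat 1 - q t)) has_vector_derivative c \<cdot>\<^sub>M (0 - q') + 0 \<cdot>\<^sub>M (mat 1 - q t)) (at t)"
    by (intro mscale_has_vector_derivative has_vector_derivative_diff has_vector_derivative_const assms)
  from has_vector_derivative_add[OF assms this] show ?thesis
    unfolding simple_factor_def
    by (rule has_vector_derivative_eq_rhs) (simp add: cmat_eq_iff algebra_simps)
qed

section \<open>Dressing\<close>

lemmas word_simps = bracket_def mult_simps mscale_simps adj_simps

text \<open>In the four identities below both sides are expanded into words in \<open>a\<close>, \<open>u\<close>, \<open>v\<close>, \<open>q\<close>,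
  reduced by \<open>q ** q = q\<close>; the entries of the remaining words can then be treated as independent
  indeterminates.\<close>

lemma dressing_xi:
  fixes a u q :: cmat
  assumes q: "q ** q = q" and au: "adj a = - a" "adj u = - u" and l: "l \<noteq> z"
  defines "A \<equiv> z \<cdot>\<^sub>M a + u" and "c \<equiv> blaschke (cnj z) l"
  shows "(l \<cdot>\<^sub>M a + u) ** simple_factor q c
      + (1 - c) \<cdot>\<^sub>M (q ** A ** (mat 1 - q) + (mat 1 - q) ** adj A ** q)
    = simple_factor q c ** (l \<cdot>\<^sub>M a + (u + (z - cnj z) \<cdot>\<^sub>M bracket q a))"
proof -
  have c: "c * (l - z) = l - cnj z" using l by (simp add: c_def blaschke_def)
  show ?thesis
    unfolding simple_factor_def A_def
    apply (simp add: word_simps q idem_mult[OF q] au)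
    unfolding cmat_eq_iff vector_add_component vector_minus_component vector_uminus_component mscale_nth
    using c by (intro conjI; algebra)
qed

lemma dressing_eta:
  fixes v q :: cmat
  assumes q: "q ** q = q" and v: "adj v = - v" and l: "l \<noteq> z" "l \<noteq> 0" and z: "z \<noteq> 0"
  defines "A \<equiv> inverse z \<cdot>\<^sub>M v" and "c \<equiv> blaschke (cnj z) l"
  shows "inverse l \<cdot>\<^sub>M (v ** simple_factor q c)
      + (1 - c) \<cdot>\<^sub>M (q ** A ** (mat 1 - q) + (mat 1 - q) ** adj A ** q)
    = inverse l \<cdot>\<^sub>M (simple_factor q c ** (complex_of_real (1 / (cmod z)\<^sup>2) \<cdot>\<^sub>M
        ((cnj z \<cdot>\<^sub>M q + z \<cdot>\<^sub>M (mat 1 - q)) ** v ** (z \<cdot>\<^sub>M q + cnj z \<cdot>\<^sub>M (mat 1 - q)))))"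
proof -
  have c: "c * (l - z) = l - cnj z" using l by (simp add: c_def blaschke_def)
  \<comment> \<open>Conjugates and inverses become the letters \<open>w\<close>, \<open>i\<close>,
    \<open>j\<close>, \<open>k\<close>, tied together by polynomial relations, so that
    \<open>algebra\<close> can work with them.\<close>
  define w where "w = cnj z"
  define i where "i = inverse z"
  define j where "j = inverse w"
  define k where "k = inverse l"
  have K: "complex_of_real (1 / (cmod z)\<^sup>2) = i * j"
    using complex_norm_square[of z] by (simp add: i_def j_def w_def field_simps)
  have e: "i * z = 1" "j * w = 1" "k * l = 1" using z l by (simp_all add: i_def j_def k_def w_def)
  have ij: "cnj i = j" by (simp add: i_def j_def w_def)
  show ?thesis
    unfolding simple_factor_def A_def K
    apply (simp add: word_simps q idem_mult[OF q] v ij i_def[symmetric] w_def[symmetric] j_def[symmetric] k_def[symmetric])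
    unfolding cmat_eq_iff vector_add_component vector_minus_component vector_uminus_component mscale_nth
    using c[folded w_def] e by (intro conjI; algebra)
qed

lemma dressing_u:
  fixes a v q :: cmat
  assumes q: "q ** q = q" and v: "adj v = - v" and z: "z \<noteq> 0"
  defines "A \<equiv> inverse z \<cdot>\<^sub>M v"
  shows "bracket a v + (z - cnj z) \<cdot>\<^sub>M bracket (q ** A ** (mat 1 - q) + (mat 1 - q) ** adj A ** q) a
    = bracket a (complex_of_real (1 / (cmod z)\<^sup>2) \<cdot>\<^sub>M
        ((cnj z \<cdot>\<^sub>M q + z \<cdot>\<^sub>M (mat 1 - q)) ** v ** (z \<cdot>\<^sub>M q + cnj z \<cdot>\<^sub>M (mat 1 - q))))"
proof -
  define w where "w = cnj z"
  define i where "i = inverse z"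
  define j where "j = inverse w"
  have K: "complex_of_real (1 / (cmod z)\<^sup>2) = i * j"
    using complex_norm_square[of z] by (simp add: i_def j_def w_def field_simps)
  have e: "i * z = 1" "j * w = 1" using z by (simp_all add: i_def j_def w_def)
  have ij: "cnj i = j" by (simp add: i_def j_def w_def)
  show ?thesis
    unfolding A_def K
    apply (simp add: word_simps q idem_mult[OF q] v ij i_def[symmetric] w_def[symmetric] j_def[symmetric])
    unfolding cmat_eq_iff vector_add_component vector_minus_component vector_uminus_component mscale_nth
    using e by (intro conjI; algebra)
qed

lemma dressing_v:
  fixes a u v q :: cmat
  assumes q: "q ** q = q" and au: "adj a = - a" "adj u = - u" and z: "z \<noteq> 0"
  defines "A \<equiv> z \<cdot>\<^sub>M a + u" and "X \<equiv> cnj z \<cdot>\<^sub>M q + z \<cdot>\<^sub>M (mat 1 - q)"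
    and "Y \<equiv> z \<cdot>\<^sub>M q + cnj z \<cdot>\<^sub>M (mat 1 - q)" and "K \<equiv> complex_of_real (1 / (cmod z)\<^sup>2)"
  defines "q' \<equiv> q ** A ** (mat 1 - q) + (mat 1 - q) ** adj A ** q"
  shows "K \<cdot>\<^sub>M (((cnj z - z) \<cdot>\<^sub>M q') ** v ** Y - X ** bracket u v ** Y + X ** v ** ((z - cnj z) \<cdot>\<^sub>M q'))
    = - bracket (u + (z - cnj z) \<cdot>\<^sub>M bracket q a) (K \<cdot>\<^sub>M (X ** v ** Y))"
proof -
  define w where "w = cnj z"
  have e: "K * z * w = 1" using z complex_norm_square[of z] by (simp add: K_def w_def field_simps)
  show ?thesis
    unfolding A_def X_def Y_def q'_def
    apply (simp add: word_simps q idem_mult[OF q] au w_def[symmetric])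
    unfolding cmat_eq_iff vector_add_component vector_minus_component vector_uminus_component mscale_nth
    by (intro conjI; simp add: algebra_simps)
qed

section \<open>Smooth matrix-valued functions of two variables\<close>

lemma smooth2_iff: "smooth2 s \<longleftrightarrow> (\<forall>n. Ck n (\<lambda>p. s (fst p) (snd p)))"
  by (simp add: smooth2_def case_prod_beta')

lemma smooth2_const: "smooth2 (\<lambda>x t. A)"
  by (simp add: smooth2_iff Ck_const)

lemma smooth2_mult: "smooth2 f \<Longrightarrow> smooth2 g \<Longrightarrow> smooth2 (\<lambda>x t. f x t ** g x t)"
  by (simp add: smooth2_iff Ck_bounded_bilinear[OF bounded_bilinear_matrix_mult])

lemma smooth2_add: "smooth2 f \<Longrightarrow> smooth2 g \<Longrightarrow> smooth2 (\<lambda>x t. f x t + g x t)"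
  by (simp add: smooth2_iff Ck_add)

lemma smooth2_mscale: "smooth2 f \<Longrightarrow> smooth2 (\<lambda>x t. c \<cdot>\<^sub>M f x t)"
  by (simp add: smooth2_iff Ck_bounded_linear[OF bounded_bilinear.bounded_linear_right[OF bounded_bilinear_mscale]])

lemma smooth2_diff: "smooth2 f \<Longrightarrow> smooth2 g \<Longrightarrow> smooth2 (\<lambda>x t. f x t - g x t)"
  using Ck_add[OF _ Ck_bounded_linear[OF bounded_linear_minus[OF bounded_linear_ident]]]
  by (fastforce simp: smooth2_iff)

lemma smooth2_adj: "smooth2 f \<Longrightarrow> smooth2 (\<lambda>x t. adj (f x t))"
  by (simp add: smooth2_iff Ck_bounded_linear[OF bounded_linear_adj])

lemma smooth2_normalize_trace:
  assumes "smooth2 N" "\<And>x t. trace (N x t) \<noteq> 0"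
  shows "smooth2 (\<lambda>x t. normalize_trace (N x t))"
  using assms
  by (simp add: smooth2_iff normalize_trace_def Ck_bounded_bilinear[OF bounded_bilinear_mscale]
      Ck_inverse Ck_bounded_linear[OF bounded_linear_trace])

lemma smooth2_simple_factor: "smooth2 q \<Longrightarrow> smooth2 (\<lambda>x t. simple_factor (q x t) c)"
  unfolding simple_factor_def
  by (intro smooth2_add smooth2_mscale smooth2_diff smooth2_const)

section \<open>Frames of solutions of the -1 flow\<close>

text \<open>The linear system of the trivialization at one spectral value \<open>l\<close>. The
  first component of the flow is a fixed matrix \<open>a\<close>, as it is for the vacuum and all
  its transforms.\<close>

definition lax_pair :: "cmat \<Rightarrow> (real \<Rightarrow> real \<Rightarrow> cmat) \<Rightarrow> (real \<Rightarrow> real \<Rightarrow> cmat) \<Rightarrow>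
    complex \<Rightarrow> (real \<Rightarrow> real \<Rightarrow> cmat) \<Rightarrow> bool" where
  "lax_pair a u v l E \<longleftrightarrow> E 0 0 = mat 1 \<and>
     (\<forall>\<xi> \<eta>. ((\<lambda>y. E y \<eta>) has_vector_derivative E \<xi> \<eta> ** (l \<cdot>\<^sub>M a + u \<xi> \<eta>)) (at \<xi>) \<and>
        ((\<lambda>y. E \<xi> y) has_vector_derivative inverse l \<cdot>\<^sub>M (E \<xi> \<eta> ** v \<xi> \<eta>)) (at \<eta>))"

text \<open>The set \<open>B\<close> collects the poles introduced by dressing; the frame \<open>E l\<close> is only
  controlled away from it.\<close>

definition flow_frame :: "cmat \<Rightarrow> (real \<Rightarrow> real \<Rightarrow> cmat) \<Rightarrow> (real \<Rightarrow> real \<Rightarrow> cmat) \<Rightarrow>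
    (complex \<Rightarrow> real \<Rightarrow> real \<Rightarrow> cmat) \<Rightarrow> complex set \<Rightarrow> bool" where
  "flow_frame a u v E B \<longleftrightarrow> minus_one_flow ((\<lambda>_ _. a), u, v) \<and> smooth2 v \<and> (\<forall>l\<in>B. cnj l \<in> B) \<and>
     (\<forall>l. l \<noteq> 0 \<longrightarrow> l \<notin> B \<longrightarrow> lax_pair a u v l (E l) \<and> smooth2 (E l) \<and>
        (\<forall>\<xi> \<eta>. adj (E (cnj l) \<xi> \<eta>) ** E l \<xi> \<eta> = mat 1 \<and> det (E l \<xi> \<eta>) = 1))"

lemma has_vector_derivative_zero_unique:
  fixes f :: "real \<Rightarrow> 'a::real_normed_vector"
  assumes "\<And>t. (f has_vector_derivative 0) (at t)"
  shows "f x = f y"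
proof -
  obtain c where "\<And>t. t \<in> UNIV \<Longrightarrow> f t = c"
    by (rule has_vector_derivative_zero_constant[of UNIV f]) (use assms in auto)
  then show ?thesis by simp
qed

text \<open>\<open>E'\<close> is a solution at \<open>cnj l\<close> and \<open>adj E'\<close> is the
  inverse of \<open>E\<close>. As \<open>a\<close>, \<open>u\<close>, \<open>v\<close> are
  skew-Hermitian, the derivatives of \<open>F ** adj E'\<close> cancel in both directions, so this
  product keeps its value 1 at the origin.\<close>

lemma lax_pair_unique:
  assumes E: "lax_pair a u v l E" and F: "lax_pair a u v l F" and E': "lax_pair a u v (cnj l) E'"
    and inv: "\<And>\<xi> \<eta>. adj (E' \<xi> \<eta>) ** E \<xi> \<eta> = mat 1"
    and su: "adj a = - a" "\<And>\<xi> \<eta>. adj (u \<xi> \<eta>) = - u \<xi> \<eta>" "\<And>\<xi> \<eta>. adj (v \<xi> \<eta>) = - v \<xi> \<eta>"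
  shows "F = E"
proof -
  define G where "G \<xi> \<eta> = F \<xi> \<eta> ** adj (E' \<xi> \<eta>)" for \<xi> \<eta>
  have "((\<lambda>y. G y \<eta>) has_vector_derivative 0) (at \<xi>)" for \<xi> \<eta>
  proof -
    have "((\<lambda>y. F y \<eta>) has_vector_derivative F \<xi> \<eta> ** (l \<cdot>\<^sub>M a + u \<xi> \<eta>)) (at \<xi>)"
      "((\<lambda>y. E' y \<eta>) has_vector_derivative E' \<xi> \<eta> ** (cnj l \<cdot>\<^sub>M a + u \<xi> \<eta>)) (at \<xi>)"
      using F E' by (simp_all add: lax_pair_def)
    from mult_has_vector_derivative[OF this(1) adj_has_vector_derivative[OF this(2)]]
    show ?thesis unfolding G_def
      by (rule has_vector_derivative_eq_rhs) (simp add: adj_simps su mult_simps mscale_simps)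
  qed
  moreover have "((\<lambda>y. G \<xi> y) has_vector_derivative 0) (at \<eta>)" for \<xi> \<eta>
  proof -
    have "((\<lambda>y. F \<xi> y) has_vector_derivative inverse l \<cdot>\<^sub>M (F \<xi> \<eta> ** v \<xi> \<eta>)) (at \<eta>)"
      "((\<lambda>y. E' \<xi> y) has_vector_derivative inverse (cnj l) \<cdot>\<^sub>M (E' \<xi> \<eta> ** v \<xi> \<eta>)) (at \<eta>)"
      using F E' by (simp_all add: lax_pair_def)
    from mult_has_vector_derivative[OF this(1) adj_has_vector_derivative[OF this(2)]]
    show ?thesis unfolding G_def
      by (rule has_vector_derivative_eq_rhs) (simp add: adj_simps su mult_simps mscale_simps)
  qed
  ultimately have "G \<xi> \<eta> = G 0 0" for \<xi> \<eta>
    using has_vector_derivative_zero_unique[of "\<lambda>y. G y \<eta>" \<xi> 0]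
      has_vector_derivative_zero_unique[of "\<lambda>y. G 0 y" \<eta> 0] by simp
  then have "G \<xi> \<eta> = mat 1" for \<xi> \<eta>
    using F E' by (simp add: G_def lax_pair_def adj_simps)
  then have "F \<xi> \<eta> = E \<xi> \<eta>" for \<xi> \<eta>
    using inv[of \<xi> \<eta>] unfolding G_def
    by (metis matrix_mul_assoc matrix_mul_lid matrix_mul_rid)
  then show ?thesis by blast
qed

lemma flow_frameD:
  assumes "flow_frame a u v E B"
  shows "adj a = - a" "trace a = 0" "adj (u \<xi> \<eta>) = - u \<xi> \<eta>" "trace (u \<xi> \<eta>) = 0"
    "adj (v \<xi> \<eta>) = - v \<xi> \<eta>" "trace (v \<xi> \<eta>) = 0"
    "((\<lambda>y. u \<xi> y) has_vector_derivative bracket a (v \<xi> \<eta>)) (at \<eta>)"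
    "((\<lambda>y. v y \<eta>) has_vector_derivative - bracket (u \<xi> \<eta>) (v \<xi> \<eta>)) (at \<xi>)"
    "smooth2 v" "l \<in> B \<Longrightarrow> cnj l \<in> B"
  using assms by (auto simp: flow_frame_def minus_one_flow_def su2_def)

lemma flow_frame_at:
  assumes "flow_frame a u v E B" "l \<noteq> 0" "l \<notin> B"
  shows "lax_pair a u v l (E l)" "smooth2 (E l)" "adj (E (cnj l) \<xi> \<eta>) ** E l \<xi> \<eta> = mat 1"
    "det (E l \<xi> \<eta>) = 1"
    "E l 0 0 = mat 1"
    "((\<lambda>y. E l y \<eta>) has_vector_derivative E l \<xi> \<eta> ** (l \<cdot>\<^sub>M a + u \<xi> \<eta>)) (at \<xi>)"
    "((\<lambda>y. E l \<xi> y) has_vector_derivative inverse l \<cdot>\<^sub>M (E l \<xi> \<eta> ** v \<xi> \<eta>)) (at \<eta>)"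
  using assms by (auto simp: flow_frame_def lax_pair_def)

text \<open>Uniqueness of solutions turns the definite description into the explicit frame; closure
  of \<open>B\<close> under conjugation makes the frame at \<open>cnj l\<close> available
  too.\<close>

lemma flow_frame_trivialization:
  assumes F: "flow_frame a u v E B" and l: "l \<noteq> 0" "l \<notin> B"
  shows "trivialization ((\<lambda>_ _. a), u, v) \<xi> \<eta> l = E l \<xi> \<eta>"
proof -
  have l': "cnj l \<noteq> 0" "cnj l \<notin> B" using l flow_frameD(10)[OF F, of "cnj l"] by auto
  have "(THE E'. lax_pair a u v l E') = E l"
  proof (rule the_equality)
    show "lax_pair a u v l (E l)" using flow_frame_at(1)[OF F l] .
  next
    fix E' assume "lax_pair a u v l E'"
    then show "E' = E l"
      using flow_frame_at(1)[OF F l] flow_frame_at(1)[OF F l'] flow_frame_at(3)[OF F l] flow_frameD[OF F]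
      by (intro lax_pair_unique[of a u v l "E l" E' "E (cnj l)"]) auto
  qed
  then show ?thesis by (simp add: trivialization_def lax_pair_def)
qed

text \<open>The trace-normalised matrix is the moving projection of the transformation. At
  \<open>l = z\<close> and \<open>l = cnj z\<close> both quotients are 0, one of them by the
  convention on division by zero, so there the value is not the holomorphic extension.\<close>

definition dress :: "complex \<Rightarrow> cmat \<Rightarrow> (complex \<Rightarrow> real \<Rightarrow> real \<Rightarrow> cmat) \<Rightarrow> complex \<Rightarrow> real \<Rightarrow> real \<Rightarrow> cmat" where
  "dress z p E l \<xi> \<eta> = simple_factor p (blaschke z l) ** E l \<xi> \<eta> **
     simple_factor (normalize_trace (adj (E z \<xi> \<eta>) ** p ** E z \<xi> \<eta>)) (blaschke (cnj z) l)"

text \<open>The frame at \<open>z\<close> determines the derivatives of the moving projection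
  \<open>q\<close>. From these, \<open>dressing_u\<close> and \<open>dressing_v\<close> give the
  flow equations for \<open>u'\<close> and \<open>v'\<close>, while \<open>dressing_xi\<close> and
  \<open>dressing_eta\<close> give the linear system of the dressed frame.\<close>

lemma flow_frame_dress:
  assumes F: "flow_frame a u v E B" and p: "rank_one_projection p"
    and z: "Im z \<noteq> 0" "z \<notin> B"
  shows "\<exists>u' v'. backlund z p ((\<lambda>_ _. a), u, v) = ((\<lambda>_ _. a), u', v') \<and>
    flow_frame a u' v' (dress z p E) (insert z (insert (cnj z) B))"
proof -
  have z0: "z \<noteq> 0" using z by auto
  note fa = flow_frameD[OF F]
  note fz = flow_frame_at[OF F z0 z(2)]
  note pD = rank_one_projectionD[OF p]
  define N where "N \<xi> \<eta> = adj (E z \<xi> \<eta>) ** p ** E z \<xi> \<eta>" for \<xi> \<eta>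
  define q where "q \<xi> \<eta> = normalize_trace (N \<xi> \<eta>)" for \<xi> \<eta>
  note Nq = pullback_projection[OF p fz(3), folded N_def, folded q_def]
  note qD = rank_one_projectionD[OF Nq(4)]
  define X where "X \<xi> \<eta> = cnj z \<cdot>\<^sub>M q \<xi> \<eta> + z \<cdot>\<^sub>M (mat 1 - q \<xi> \<eta>)" for \<xi> \<eta>
  define Y where "Y \<xi> \<eta> = z \<cdot>\<^sub>M q \<xi> \<eta> + cnj z \<cdot>\<^sub>M (mat 1 - q \<xi> \<eta>)" for \<xi> \<eta>
  define K where "K = complex_of_real (1 / (cmod z)\<^sup>2)"
  have Kz: "K * z * cnj z = 1" using z0 complex_norm_square[of z] by (simp add: K_def field_simps)
  define u' where "u' \<xi> \<eta> = u \<xi> \<eta> + (z - cnj z) \<cdot>\<^sub>M bracket (q \<xi> \<eta>) a" for \<xi> \<eta>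
  define v' where "v' \<xi> \<eta> = K \<cdot>\<^sub>M (X \<xi> \<eta> ** v \<xi> \<eta> ** Y \<xi> \<eta>)" for \<xi> \<eta>
  \<comment> \<open>\<open>A1\<close> and \<open>A2\<close> are the coefficients of the linear
    system at the spectral value \<open>z\<close> in the two light-cone directions, and
    \<open>dq\<close> is the derivative of \<open>q\<close> that such a coefficient induces.\<close>
  define A1 where "A1 \<xi> \<eta> = z \<cdot>\<^sub>M a + u \<xi> \<eta>" for \<xi> \<eta>
  define A2 where "A2 \<xi> \<eta> = inverse z \<cdot>\<^sub>M v \<xi> \<eta>" for \<xi> \<eta>
  define dq where "dq A \<xi> \<eta> = q \<xi> \<eta> ** A ** (mat 1 - q \<xi> \<eta>) + (mat 1 - q \<xi> \<eta>) ** adj A ** q \<xi> \<eta>" for A \<xi> \<eta>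
  have bl: "backlund z p ((\<lambda>_ _. a), u, v) = ((\<lambda>_ _. a), u', v')"
    unfolding backlund_def Let_def case_prod_conv flow_frame_trivialization[OF F z0 z(2)] Nq(5)
    by (simp add: u'_def v'_def X_def Y_def K_def fun_eq_iff)
  have q1: "((\<lambda>y. q y \<eta>) has_vector_derivative dq (A1 \<xi> \<eta>) \<xi> \<eta>) (at \<xi>)" for \<xi> \<eta>
    unfolding q_def dq_def
  proof (rule normalize_trace_has_vector_derivative)
    have "((\<lambda>y. adj (E z y \<eta>) ** p ** E z y \<eta>) has_vector_derivative
      adj (E z \<xi> \<eta>) ** p ** (E z \<xi> \<eta> ** A1 \<xi> \<eta>) +
      (adj (E z \<xi> \<eta>) ** 0 + adj (E z \<xi> \<eta> ** A1 \<xi> \<eta>) ** p) ** E z \<xi> \<eta>) (at \<xi>)"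
      unfolding A1_def
      by (intro mult_has_vector_derivative adj_has_vector_derivative has_vector_derivative_const fz)
    then show "((\<lambda>y. N y \<eta>) has_vector_derivative adj (A1 \<xi> \<eta>) ** N \<xi> \<eta> + N \<xi> \<eta> ** A1 \<xi> \<eta>) (at \<xi>)"
      unfolding N_def
      by (rule has_vector_derivative_eq_rhs) (simp add: mult_simps adj_simps)
  qed (use Nq in auto)
  have q2: "((\<lambda>y. q \<xi> y) has_vector_derivative dq (A2 \<xi> \<eta>) \<xi> \<eta>) (at \<eta>)" for \<xi> \<eta>
    unfolding q_def dq_def
  proof (rule normalize_trace_has_vector_derivative)
    have "((\<lambda>y. adj (E z \<xi> y) ** p ** E z \<xi> y) has_vector_derivative
      adj (E z \<xi> \<eta>) ** p ** (inverse z \<cdot>\<^sub>M (E z \<xi> \<eta> ** v \<xi> \<eta>)) +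
      (adj (E z \<xi> \<eta>) ** 0 + adj (inverse z \<cdot>\<^sub>M (E z \<xi> \<eta> ** v \<xi> \<eta>)) ** p) ** E z \<xi> \<eta>) (at \<eta>)"
      by (intro mult_has_vector_derivative adj_has_vector_derivative has_vector_derivative_const fz)
    then show "((\<lambda>y. N \<xi> y) has_vector_derivative adj (A2 \<xi> \<eta>) ** N \<xi> \<eta> + N \<xi> \<eta> ** A2 \<xi> \<eta>) (at \<eta>)"
      unfolding N_def A2_def
      by (rule has_vector_derivative_eq_rhs) (simp add: mult_simps adj_simps)
  qed (use Nq in auto)
  have sq: "smooth2 q"
    unfolding q_def[abs_def] using Nq(3) fz(2)
    by (intro smooth2_normalize_trace) (auto simp: N_def intro!: smooth2_mult smooth2_adj smooth2_const)
  have sv: "smooth2 v'"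
    unfolding v'_def[abs_def] X_def Y_def using fa(9) sq
    by (intro smooth2_mult smooth2_mscale smooth2_add smooth2_diff smooth2_const)
  \<comment> \<open>With \<open>Kz\<close> this makes \<open>v'\<close> similar to \<open>v\<close>,
    so its trace stays 0.\<close>
  have YX: "Y \<xi> \<eta> ** X \<xi> \<eta> = (z * cnj z) \<cdot>\<^sub>M mat 1" for \<xi> \<eta>
    unfolding X_def Y_def
    by (simp add: mult_simps mscale_simps qD(1)) (simp add: cmat_eq_iff algebra_simps)
  have su_u: "u' \<xi> \<eta> \<in> su2" for \<xi> \<eta>
    unfolding su2_def u'_def
    by (auto simp: bracket_def adj_simps mult_simps mscale_simps fa qD)
       (simp_all add: trace_2 mult_nth cmat_eq_iff algebra_simps fa(4)[of \<xi> \<eta>, unfolded trace_2])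
  have tr_v: "trace (v' \<xi> \<eta>) = 0" for \<xi> \<eta>
  proof -
    have "trace (v' \<xi> \<eta>) = K * trace (v \<xi> \<eta> ** (Y \<xi> \<eta> ** X \<xi> \<eta>))"
      using trace_mul_sym[of "X \<xi> \<eta>" "v \<xi> \<eta> ** Y \<xi> \<eta>"]
      by (simp add: v'_def matrix_mul_assoc trace_mscale)
    also have "\<dots> = 0"
      unfolding YX using fa(6)[of \<xi> \<eta>] by (simp add: mult_simps trace_mscale)
    finally show ?thesis .
  qed
  have su_v: "v' \<xi> \<eta> \<in> su2" for \<xi> \<eta>
  proof -
    have "cnj K = K" by (simp add: K_def)
    moreover have "adj (X \<xi> \<eta>) = Y \<xi> \<eta>" "adj (Y \<xi> \<eta>) = X \<xi> \<eta>"
      by (simp_all add: X_def Y_def adj_simps qD)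
    ultimately show ?thesis
      using tr_v by (simp add: su2_def v'_def adj_simps fa mult_simps mscale_simps)
  qed
  have flow: "minus_one_flow ((\<lambda>_ _. a), u', v')"
    unfolding minus_one_flow_def case_prod_conv
  proof (intro allI conjI)
    fix \<xi> \<eta>
    show "a \<in> su2" using fa by (simp add: su2_def)
    show "u' \<xi> \<eta> \<in> su2" "v' \<xi> \<eta> \<in> su2" using su_u su_v by auto
    show "((\<lambda>y. a) has_vector_derivative 0) (at \<eta>)" by simp
    \<comment> \<open>The zero terms are the derivatives of constant factors; they are written out
      so that the derivative has literally the shape produced by the product rule.\<close>
    have "((\<lambda>y. u \<xi> y + (z - cnj z) \<cdot>\<^sub>M (q \<xi> y ** a - a ** q \<xi> y)) has_vector_derivative
       bracket a (v \<xi> \<eta>) + ((z - cnj z) \<cdot>\<^sub>M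
          ((q \<xi> \<eta> ** 0 + dq (A2 \<xi> \<eta>) \<xi> \<eta> ** a) - (a ** dq (A2 \<xi> \<eta>) \<xi> \<eta> + 0 ** q \<xi> \<eta>)) +
        0 \<cdot>\<^sub>M (q \<xi> \<eta> ** a - a ** q \<xi> \<eta>))) (at \<eta>)"
      by (intro has_vector_derivative_add mscale_has_vector_derivative has_vector_derivative_diff
        mult_has_vector_derivative has_vector_derivative_const fa q2)
    moreover have "bracket a (v \<xi> \<eta>) + ((z - cnj z) \<cdot>\<^sub>M
          ((q \<xi> \<eta> ** 0 + dq (A2 \<xi> \<eta>) \<xi> \<eta> ** a) - (a ** dq (A2 \<xi> \<eta>) \<xi> \<eta> + 0 ** q \<xi> \<eta>)) +
        0 \<cdot>\<^sub>M (q \<xi> \<eta> ** a - a ** q \<xi> \<eta>))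
      = bracket a (v \<xi> \<eta>) + (z - cnj z) \<cdot>\<^sub>M bracket (dq (A2 \<xi> \<eta>) \<xi> \<eta>) a"
      by (simp add: bracket_def mult_simps mscale_simps)
    ultimately show "((\<lambda>y. u' \<xi> y) has_vector_derivative bracket a (v' \<xi> \<eta>)) (at \<eta>)"
      using dressing_u[OF qD(1)[of \<xi> \<eta>] fa(5)[of \<xi> \<eta>] z0, of a]
      unfolding u'_def bracket_def[of "q _ _"] v'_def X_def Y_def K_def dq_def A2_def by simp
    have "((\<lambda>y. K \<cdot>\<^sub>M (X y \<eta> ** v y \<eta> ** Y y \<eta>)) has_vector_derivative
       K \<cdot>\<^sub>M (X \<xi> \<eta> ** v \<xi> \<eta> ** ((z \<cdot>\<^sub>M dq (A1 \<xi> \<eta>) \<xi> \<eta> + 0 \<cdot>\<^sub>M q \<xi> \<eta>) + (cnj z \<cdot>\<^sub>M (0 - dq (A1 \<xi> \<eta>) \<xi> \<eta>) + 0 \<cdot>\<^sub>M (mat 1 - q \<xi> \<eta>)))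
         + (X \<xi> \<eta> ** - bracket (u \<xi> \<eta>) (v \<xi> \<eta>) +
         ((cnj z \<cdot>\<^sub>M dq (A1 \<xi> \<eta>) \<xi> \<eta> + 0 \<cdot>\<^sub>M q \<xi> \<eta>) + (z \<cdot>\<^sub>M (0 - dq (A1 \<xi> \<eta>) \<xi> \<eta>) + 0 \<cdot>\<^sub>M (mat 1 - q \<xi> \<eta>))) ** v \<xi> \<eta>) ** Y \<xi> \<eta>)
        + 0 \<cdot>\<^sub>M (X \<xi> \<eta> ** v \<xi> \<eta> ** Y \<xi> \<eta>)) (at \<xi>)"
      unfolding X_def Y_def
      by (intro has_vector_derivative_add mscale_has_vector_derivative has_vector_derivative_diff
        mult_has_vector_derivative has_vector_derivative_const fa q1)
    moreover have "K \<cdot>\<^sub>M (X \<xi> \<eta> ** v \<xi> \<eta> ** ((z \<cdot>\<^sub>M dq (A1 \<xi> \<eta>) \<xi> \<eta> + 0 \<cdot>\<^sub>M q \<xi> \<eta>) + (cnj z \<cdot>\<^sub>M (0 - dq (A1 \<xi> \<eta>) \<xi> \<eta>) + 0 \<cdot>\<^sub>M (mat 1 - q \<xi> \<eta>)))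
         + (X \<xi> \<eta> ** - bracket (u \<xi> \<eta>) (v \<xi> \<eta>) +
         ((cnj z \<cdot>\<^sub>M dq (A1 \<xi> \<eta>) \<xi> \<eta> + 0 \<cdot>\<^sub>M q \<xi> \<eta>) + (z \<cdot>\<^sub>M (0 - dq (A1 \<xi> \<eta>) \<xi> \<eta>) + 0 \<cdot>\<^sub>M (mat 1 - q \<xi> \<eta>))) ** v \<xi> \<eta>) ** Y \<xi> \<eta>)
        + 0 \<cdot>\<^sub>M (X \<xi> \<eta> ** v \<xi> \<eta> ** Y \<xi> \<eta>)
      = K \<cdot>\<^sub>M (((cnj z - z) \<cdot>\<^sub>M dq (A1 \<xi> \<eta>) \<xi> \<eta>) ** v \<xi> \<eta> ** Y \<xi> \<eta> - X \<xi> \<eta> ** bracket (u \<xi> \<eta>) (v \<xi> \<eta>) ** Y \<xi> \<eta>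
         + X \<xi> \<eta> ** v \<xi> \<eta> ** ((z - cnj z) \<cdot>\<^sub>M dq (A1 \<xi> \<eta>) \<xi> \<eta>))"
      by (simp add: mult_simps mscale_simps) (simp add: cmat_eq_iff algebra_simps)
    ultimately show "((\<lambda>y. v' y \<eta>) has_vector_derivative - bracket (u' \<xi> \<eta>) (v' \<xi> \<eta>)) (at \<xi>)"
      using dressing_v[OF qD(1)[of \<xi> \<eta>] fa(1) fa(3)[of \<xi> \<eta>] z0, of "v \<xi> \<eta>"]
      unfolding u'_def v'_def X_def Y_def K_def dq_def A1_def by simp
  qed
  have cl: "\<forall>l\<in>insert z (insert (cnj z) B). cnj l \<in> insert z (insert (cnj z) B)"
    using fa(10) by auto
  have fr: "lax_pair a u' v' l (dress z p E l) \<and> smooth2 (dress z p E l) \<and>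
        (\<forall>\<xi> \<eta>. adj (dress z p E (cnj l) \<xi> \<eta>) ** dress z p E l \<xi> \<eta> = mat 1 \<and> det (dress z p E l \<xi> \<eta>) = 1)"
    if l: "l \<noteq> 0" "l \<notin> insert z (insert (cnj z) B)" for l
  proof (intro conjI allI)
    have lz: "l \<noteq> z" "l \<noteq> cnj z" "l \<notin> B" using l by auto
    note fl = flow_frame_at[OF F l(1) lz(3)]
    define c where "c = blaschke (cnj z) l"
    define c' where "c' = blaschke z l"
    have cc: "c * c' = 1" "c' * c = 1" using blaschke_inverse[OF lz(1,2)] by (simp_all add: c_def c'_def mult.commute)
    define g where "g = simple_factor p c'"
    define h where "h \<xi> \<eta> = simple_factor (q \<xi> \<eta>) c" for \<xi> \<eta>
    have D: "dress z p E l = (\<lambda>\<xi> \<eta>. g ** E l \<xi> \<eta> ** h \<xi> \<eta>)"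
      by (simp add: dress_def fun_eq_iff g_def h_def c_def c'_def q_def N_def)
    show "smooth2 (dress z p E l)"
      unfolding D h_def by (intro smooth2_mult smooth2_const fl smooth2_simple_factor sq)
    show "det (dress z p E l \<xi> \<eta>) = 1" for \<xi> \<eta>
      unfolding D g_def h_def using cc
      by (simp add: det_mul simple_factor_det pD qD fl)
    show "adj (dress z p E (cnj l) \<xi> \<eta>) ** dress z p E l \<xi> \<eta> = mat 1" for \<xi> \<eta>
    proof -
      have "adj (dress z p E (cnj l) \<xi> \<eta>) = simple_factor (q \<xi> \<eta>) c' ** adj (E (cnj l) \<xi> \<eta>) ** simple_factor p c"
        by (simp add: dress_def adj_simps simple_factor_adj pD qD N_def[symmetric] q_def[symmetric]
             blaschke_cnj c_def c'_def matrix_mul_assoc)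
      then have "adj (dress z p E (cnj l) \<xi> \<eta>) ** dress z p E l \<xi> \<eta> =
         simple_factor (q \<xi> \<eta>) c' ** (adj (E (cnj l) \<xi> \<eta>) ** (simple_factor p c ** g) ** E l \<xi> \<eta>) ** h \<xi> \<eta>"
        by (simp add: D matrix_mul_assoc)
      then show ?thesis
        by (simp add: g_def h_def simple_factor_mult pD qD cc fl)
    qed
    show "lax_pair a u' v' l (dress z p E l)"
      unfolding lax_pair_def
    proof (intro conjI allI)
      \<comment> \<open>At the origin the frame is the identity, so \<open>q\<close> starts at
        \<open>p\<close> and the left and right simple factors cancel.\<close>
      have "N 0 0 = p" using fz(5) by (simp add: N_def adj_simps)
      then have "q 0 0 = p" using pD by (simp add: q_def normalize_trace_projection)
      then show "dress z p E l 0 0 = mat 1"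
        unfolding D g_def h_def by (simp add: fl simple_factor_mult pD cc)
      fix \<xi> \<eta>
      have "((\<lambda>y. g ** E l y \<eta> ** h y \<eta>) has_vector_derivative
         g ** E l \<xi> \<eta> ** ((1 - c) \<cdot>\<^sub>M dq (A1 \<xi> \<eta>) \<xi> \<eta>) +
          (g ** (E l \<xi> \<eta> ** (l \<cdot>\<^sub>M a + u \<xi> \<eta>)) + 0 ** E l \<xi> \<eta>) ** h \<xi> \<eta>) (at \<xi>)"
        unfolding h_def
        by (intro mult_has_vector_derivative has_vector_derivative_const fl
            simple_factor_has_vector_derivative q1)
      moreover have "g ** E l \<xi> \<eta> ** ((1 - c) \<cdot>\<^sub>M dq (A1 \<xi> \<eta>) \<xi> \<eta>) +
          (g ** (E l \<xi> \<eta> ** (l \<cdot>\<^sub>M a + u \<xi> \<eta>)) + 0 ** E l \<xi> \<eta>) ** h \<xi> \<eta>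
        = g ** E l \<xi> \<eta> ** ((l \<cdot>\<^sub>M a + u \<xi> \<eta>) ** h \<xi> \<eta> + (1 - c) \<cdot>\<^sub>M dq (A1 \<xi> \<eta>) \<xi> \<eta>)"
        by (simp add: mult_simps)
      \<comment> \<open>\<open>h\<close> intertwines the two systems: the old coefficient on its
        left plus its own derivative equals the new coefficient on its right.\<close>
      moreover have "(l \<cdot>\<^sub>M a + u \<xi> \<eta>) ** h \<xi> \<eta> + (1 - c) \<cdot>\<^sub>M dq (A1 \<xi> \<eta>) \<xi> \<eta>
         = h \<xi> \<eta> ** (l \<cdot>\<^sub>M a + u' \<xi> \<eta>)"
        using dressing_xi[OF qD(1)[of \<xi> \<eta>] fa(1) fa(3)[of \<xi> \<eta>] lz(1)]
        unfolding h_def c_def dq_def A1_def u'_def .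
      ultimately show "((\<lambda>y. dress z p E l y \<eta>) has_vector_derivative
          dress z p E l \<xi> \<eta> ** (l \<cdot>\<^sub>M a + u' \<xi> \<eta>)) (at \<xi>)"
        unfolding D by (simp add: matrix_mul_assoc)
      have "((\<lambda>y. g ** E l \<xi> y ** h \<xi> y) has_vector_derivative
         g ** E l \<xi> \<eta> ** ((1 - c) \<cdot>\<^sub>M dq (A2 \<xi> \<eta>) \<xi> \<eta>) +
          (g ** (inverse l \<cdot>\<^sub>M (E l \<xi> \<eta> ** v \<xi> \<eta>)) + 0 ** E l \<xi> \<eta>) ** h \<xi> \<eta>) (at \<eta>)"
        unfolding h_def
        by (intro mult_has_vector_derivative has_vector_derivative_const fl
            simple_factor_has_vector_derivative q2)
      moreover have "g ** E l \<xi> \<eta> ** ((1 - c) \<cdot>\<^sub>M dq (A2 \<xi> \<eta>) \<xi> \<eta>) +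
          (g ** (inverse l \<cdot>\<^sub>M (E l \<xi> \<eta> ** v \<xi> \<eta>)) + 0 ** E l \<xi> \<eta>) ** h \<xi> \<eta>
        = g ** E l \<xi> \<eta> ** (inverse l \<cdot>\<^sub>M (v \<xi> \<eta> ** h \<xi> \<eta>) + (1 - c) \<cdot>\<^sub>M dq (A2 \<xi> \<eta>) \<xi> \<eta>)"
        by (simp add: mult_simps)
      moreover have "inverse l \<cdot>\<^sub>M (v \<xi> \<eta> ** h \<xi> \<eta>) + (1 - c) \<cdot>\<^sub>M dq (A2 \<xi> \<eta>) \<xi> \<eta>
         = inverse l \<cdot>\<^sub>M (h \<xi> \<eta> ** v' \<xi> \<eta>)"
        using dressing_eta[OF qD(1)[of \<xi> \<eta>] fa(5)[of \<xi> \<eta>] lz(1) l(1) z0]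
        unfolding h_def c_def dq_def A2_def v'_def X_def Y_def K_def .
      moreover have "g ** E l \<xi> \<eta> ** (inverse l \<cdot>\<^sub>M (h \<xi> \<eta> ** v' \<xi> \<eta>)) =
          inverse l \<cdot>\<^sub>M (dress z p E l \<xi> \<eta> ** v' \<xi> \<eta>)"
        by (simp add: D mult_simps)
      ultimately show "((\<lambda>y. dress z p E l \<xi> y) has_vector_derivative
          inverse l \<cdot>\<^sub>M (dress z p E l \<xi> \<eta> ** v' \<xi> \<eta>)) (at \<eta>)"
        unfolding D by simp
    qed
  qed
  from flow sv cl fr have "flow_frame a u' v' (dress z p E) (insert z (insert (cnj z) B))"
    unfolding flow_frame_def by blast
  with bl show ?thesis by blast
qed

section \<open>The wave map of a frame\<close>

lemma matrix_inv_eq: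
  fixes A B :: cmat
  assumes "B ** A = mat 1"
  shows "matrix_inv A = B"
proof -
  have AB: "A ** B = mat 1" using assms by (simp add: matrix_left_right_inverse)
  then have "\<exists>C. A ** C = mat 1 \<and> C ** A = mat 1" using assms by blast
  from someI_ex[OF this] have "A ** matrix_inv A = mat 1" by (simp add: matrix_inv_def)
  then have "B ** A ** matrix_inv A = B" by (simp add: matrix_mul_assoc[symmetric])
  then show ?thesis using assms by simp
qed

lemma smooth2_has_derivative:
  assumes "smooth2 W"
  obtains W' where "((\<lambda>p. W (fst p) (snd p)) has_derivative W') (at (\<xi>, \<eta>))"
proof -
  have "Ck (Suc 0) (\<lambda>p. W (fst p) (snd p))" using assms by (simp only: smooth2_iff)
  then show thesis using that by (rule Ck_SucE) blast
qed

lemma smooth2_partials: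
  assumes "smooth2 W"
  obtains W1 W2 where "((\<lambda>y. W y \<eta>) has_vector_derivative W1) (at \<xi>)"
    "((\<lambda>y. W \<xi> y) has_vector_derivative W2) (at \<eta>)"
proof -
  obtain W' where W': "((\<lambda>p. W (fst p) (snd p)) has_derivative W') (at (\<xi>, \<eta>))"
    using assms by (rule smooth2_has_derivative)
  have "((\<lambda>y. (y, \<eta>)) has_vector_derivative (1, 0)) (at \<xi>)"
    "((\<lambda>y. (\<xi>, y)) has_vector_derivative (0, 1)) (at \<eta>)"
    unfolding has_vector_derivative_def by (auto intro!: derivative_eq_intros simp: fun_eq_iff)
  from vector_derivative_diff_chain_within[OF this(1), of "\<lambda>p. W (fst p) (snd p)" W']
    vector_derivative_diff_chain_within[OF this(2), of "\<lambda>p. W (fst p) (snd p)" W'] W'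
  show thesis using that by (auto simp: o_def intro: has_derivative_at_withinI)
qed

text \<open>Chain rule along the diagonals. Smoothness provides a total derivative, whose values on
  the axes are \<open>W1\<close> and \<open>W2\<close>; the halves come from \<xi> = (x + t)/2 and
  \<eta> = (x - t)/2.\<close>

lemma lightcone_derivatives:
  assumes W: "smooth2 W"
    and W1: "((\<lambda>y. W y ((x - t) / 2)) has_vector_derivative W1) (at ((x + t) / 2))"
    and W2: "((\<lambda>y. W ((x + t) / 2) y) has_vector_derivative W2) (at ((x - t) / 2))"
  shows "((\<lambda>x. W ((x + t) / 2) ((x - t) / 2)) has_vector_derivative (1 / 2) *\<^sub>R (W1 + W2)) (at x)"
    "((\<lambda>t. W ((x + t) / 2) ((x - t) / 2)) has_vector_derivative (1 / 2) *\<^sub>R (W1 - W2)) (at t)"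
proof -
  let ?W = "\<lambda>p. W (fst p) (snd p)"
  obtain W' where W': "(?W has_derivative W') (at ((x + t) / 2, (x - t) / 2))"
    using W by (rule smooth2_has_derivative)
  interpret bounded_linear W' using W' by (rule has_derivative_bounded_linear)
  have chain: "((\<lambda>y. ?W (f y)) has_vector_derivative W' f') (at s)"
    if "(f has_vector_derivative f') (at s)" "f s = ((x + t) / 2, (x - t) / 2)" for f f' s
    using vector_derivative_diff_chain_within[OF that(1), of ?W W'] W' that(2)
    by (simp add: o_def has_derivative_at_withinI)
  have "((\<lambda>y. (y, (x - t) / 2)) has_vector_derivative (1, 0)) (at ((x + t) / 2))"
    unfolding has_vector_derivative_def by (auto intro!: derivative_eq_intros simp: fun_eq_iff)
  from chain[OF this] have w1: "W' (1, 0) = W1"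
    using vector_derivative_unique_at[OF _ W1] by simp
  have "((\<lambda>y. ((x + t) / 2, y)) has_vector_derivative (0, 1)) (at ((x - t) / 2))"
    unfolding has_vector_derivative_def by (auto intro!: derivative_eq_intros simp: fun_eq_iff)
  from chain[OF this] have w2: "W' (0, 1) = W2"
    using vector_derivative_unique_at[OF _ W2] by simp
  have e: "(1/2, 1/2) = (1/2) *\<^sub>R (((1, 0) :: real \<times> real) + (0, 1))"
    "(1/2, - (1/2)) = (1/2) *\<^sub>R (((1, 0) :: real \<times> real) - (0, 1))" by auto
  have d: "W' (1/2, 1/2) = (1/2) *\<^sub>R (W1 + W2)" "W' (1/2, - (1/2)) = (1/2) *\<^sub>R (W1 - W2)"
    unfolding e scaleR add diff w1 w2 by simp_all
  have "((\<lambda>x. ((x + t) / 2, (x - t) / 2)) has_vector_derivative (1/2, 1/2)) (at x)"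
    unfolding has_vector_derivative_def by (auto intro!: derivative_eq_intros simp: fun_eq_iff)
  from chain[OF this] show "((\<lambda>x. W ((x + t) / 2) ((x - t) / 2)) has_vector_derivative (1 / 2) *\<^sub>R (W1 + W2)) (at x)"
    by (simp add: d)
  have "((\<lambda>t. ((x + t) / 2, (x - t) / 2)) has_vector_derivative (1/2, - (1/2))) (at t)"
    unfolding has_vector_derivative_def by (auto intro!: derivative_eq_intros simp: fun_eq_iff)
  from chain[OF this] show "((\<lambda>t. W ((x + t) / 2) ((x - t) / 2)) has_vector_derivative (1 / 2) *\<^sub>R (W1 - W2)) (at t)"
    by (simp add: d)
qed

lemma smooth2_lightcone:
  assumes "smooth2 W"
  shows "smooth2 (\<lambda>x t. W ((x + t) / 2) ((x - t) / 2))"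
proof -
  define L where "L p = ((fst p + snd p) / 2, (fst p - snd p) / 2)" for p :: "real \<times> real"
  have "bounded_linear L"
    unfolding linear_conv_bounded_linear[symmetric]
    by (auto intro!: linearI simp: L_def field_simps)
  from Ck_compose_linear[OF this] assms have "Ck n (\<lambda>p. W (fst (L p)) (snd (L p)))" for n
    by (simp only: smooth2_iff) fast
  then show ?thesis by (simp add: smooth2_iff L_def)
qed

lemma flow_wave_map_eq:
  assumes F: "flow_frame a u v E B" and B: "1 \<notin> B" "- 1 \<notin> B"
  shows "flow_wave_map ((\<lambda>_ _. a), u, v) x t =
    E (- 1) ((x + t) / 2) ((x - t) / 2) ** adj (E 1 ((x + t) / 2) ((x - t) / 2))"
  using flow_frame_trivialization[OF F] B matrix_inv_eq[OF flow_frame_at(3)[OF F _ B(1)]]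
  by (simp add: flow_wave_map_def Let_def)

text \<open>With \<open>X\<close> and \<open>Y\<close> the conjugates of \<open>a\<close> and
  \<open>v\<close> by the frame at 1, the inverse of s times s_x is -(X + Y), and times s_t it is Y
  - X. The wave equation then says that the \<eta>-derivative of \<open>X\<close> and the
  \<xi>-derivative of \<open>Y\<close> add up to 0, which \<open>X2\<close> and \<open>Y1\<close>
  provide.\<close>

lemma wave_map_flow_wave_map:
  assumes F: "flow_frame a u v E B" and B: "1 \<notin> B" "- 1 \<notin> B"
  shows "wave_map (flow_wave_map ((\<lambda>_ _. a), u, v))"
proof -
  note fa = flow_frameD[OF F]
  note f1 = flow_frame_at[OF F one_neq_zero B(1), simplified]
  have "- 1 \<noteq> (0 :: complex)" by simp
  note f2 = flow_frame_at[OF F this B(2), simplified]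
  define s where "s \<xi> \<eta> = E (- 1) \<xi> \<eta> ** adj (E 1 \<xi> \<eta>)" for \<xi> \<eta>
  define X where "X \<xi> \<eta> = E 1 \<xi> \<eta> ** a ** adj (E 1 \<xi> \<eta>)" for \<xi> \<eta>
  define Y where "Y \<xi> \<eta> = E 1 \<xi> \<eta> ** v \<xi> \<eta> ** adj (E 1 \<xi> \<eta>)" for \<xi> \<eta>
  have S: "flow_wave_map ((\<lambda>_ _. a), u, v) = (\<lambda>x t. s ((x + t) / 2) ((x - t) / 2))"
    by (simp add: fun_eq_iff flow_wave_map_eq[OF F B] s_def)
  have smooth: "smooth2 s" "smooth2 X" "smooth2 Y"
    unfolding s_def[abs_def] X_def[abs_def] Y_def[abs_def]
    by (intro smooth2_mult smooth2_adj smooth2_const f1 f2 fa)+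
  have inv: "E 1 \<xi> \<eta> ** adj (E 1 \<xi> \<eta>) = mat 1" "E (- 1) \<xi> \<eta> ** adj (E (- 1) \<xi> \<eta>) = mat 1" for \<xi> \<eta>
    using f1(3) f2(3) by (simp_all add: matrix_left_right_inverse)
  have inv_s: "(E 1 \<xi> \<eta> ** adj (E (- 1) \<xi> \<eta>)) ** s \<xi> \<eta> = mat 1" for \<xi> \<eta>
  proof -
    have "(E 1 \<xi> \<eta> ** adj (E (- 1) \<xi> \<eta>)) ** s \<xi> \<eta> =
        E 1 \<xi> \<eta> ** (adj (E (- 1) \<xi> \<eta>) ** E (- 1) \<xi> \<eta>) ** adj (E 1 \<xi> \<eta>)"
      by (simp add: s_def matrix_mul_assoc)
    then show ?thesis by (simp add: f2 inv)
  qed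
  have SU: "s \<xi> \<eta> \<in> SU2" for \<xi> \<eta>
    using inv_s[of \<xi> \<eta>] by (simp add: SU2_def s_def adj_simps det_mul det_adj f1 f2)
  \<comment> \<open>The spectral values -1 and 1 contribute \<open>- a + u\<close> and, through the
    adjoint, \<open>- a - u\<close>; hence \<open>u\<close> drops out.\<close>
  have s1: "((\<lambda>y. s y \<eta>) has_vector_derivative - (2 \<cdot>\<^sub>M (E (- 1) \<xi> \<eta> ** a ** adj (E 1 \<xi> \<eta>)))) (at \<xi>)" for \<xi> \<eta>
    unfolding s_def
    by (rule has_vector_derivative_eq_rhs[OF mult_has_vector_derivative[OF f2(6) adj_has_vector_derivative[OF f1(6)]]])
       (simp add: mult_simps mscale_simps adj_simps fa, simp add: cmat_eq_iff)
  have s2: "((\<lambda>y. s \<xi> y) has_vector_derivative - (2 \<cdot>\<^sub>M (E (- 1) \<xi> \<eta> ** v \<xi> \<eta> ** adj (E 1 \<xi> \<eta>)))) (at \<eta>)" for \<xi> \<eta>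
    unfolding s_def
    by (rule has_vector_derivative_eq_rhs[OF mult_has_vector_derivative[OF f2(7) adj_has_vector_derivative[OF f1(7)]]])
       (simp add: mult_simps mscale_simps adj_simps fa, simp add: cmat_eq_iff)
  have X2: "((\<lambda>y. X \<xi> y) has_vector_derivative E 1 \<xi> \<eta> ** bracket (v \<xi> \<eta>) a ** adj (E 1 \<xi> \<eta>)) (at \<eta>)" for \<xi> \<eta>
    unfolding X_def
    by (rule has_vector_derivative_eq_rhs[OF mult_has_vector_derivative[OF
          mult_has_vector_derivative[OF f1(7) has_vector_derivative_const] adj_has_vector_derivative[OF f1(7)]]])
       (simp add: word_simps fa)
  have Y1: "((\<lambda>y. Y y \<eta>) has_vector_derivative - (E 1 \<xi> \<eta> ** bracket (v \<xi> \<eta>) a ** adj (E 1 \<xi> \<eta>))) (at \<xi>)" for \<xi> \<eta>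
    unfolding Y_def
    by (rule has_vector_derivative_eq_rhs[OF mult_has_vector_derivative[OF
          mult_has_vector_derivative[OF f1(6) fa(8)] adj_has_vector_derivative[OF f1(6)]]])
       (simp add: word_simps fa)
  let ?l = "\<lambda>f x t. f ((x + t) / 2) ((x - t) / 2) :: cmat"
  have cancel: "(E 1 \<xi> \<eta> ** adj (E (- 1) \<xi> \<eta>)) ** (E (- 1) \<xi> \<eta> ** M ** adj (E 1 \<xi> \<eta>)) = E 1 \<xi> \<eta> ** M ** adj (E 1 \<xi> \<eta>)" for \<xi> \<eta> M
  proof -
    have "(E 1 \<xi> \<eta> ** adj (E (- 1) \<xi> \<eta>)) ** (E (- 1) \<xi> \<eta> ** M ** adj (E 1 \<xi> \<eta>)) =
        E 1 \<xi> \<eta> ** (adj (E (- 1) \<xi> \<eta>) ** E (- 1) \<xi> \<eta>) ** M ** adj (E 1 \<xi> \<eta>)"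
      by (simp add: matrix_mul_assoc)
    then show ?thesis by (simp add: f2)
  qed
  have half: "(1 / 2) *\<^sub>R (- (2 \<cdot>\<^sub>M P) + - (2 \<cdot>\<^sub>M Q)) = - (P + Q)"
    "(1 / 2) *\<^sub>R (- (2 \<cdot>\<^sub>M P) - - (2 \<cdot>\<^sub>M Q)) = Q - P" for P Q
    by (simp_all add: cmat_eq_iff) (simp_all add: scaleR_conv_of_real algebra_simps)
  have D1: "(\<lambda>x t. matrix_inv (?l s x t) ** d1 (?l s) x t) = ?l (\<lambda>\<xi> \<eta>. - (X \<xi> \<eta> + Y \<xi> \<eta>))"
    unfolding d1_def fun_eq_iff vector_derivative_at[OF lightcone_derivatives(1)[OF smooth(1) s1 s2]]
      matrix_inv_eq[OF inv_s] half
    by (simp add: mult_simps(1-6) cancel X_def Y_def)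
  have D2: "(\<lambda>x t. matrix_inv (?l s x t) ** d2 (?l s) x t) = ?l (\<lambda>\<xi> \<eta>. Y \<xi> \<eta> - X \<xi> \<eta>)"
    unfolding d2_def fun_eq_iff vector_derivative_at[OF lightcone_derivatives(2)[OF smooth(1) s1 s2]]
      matrix_inv_eq[OF inv_s] half
    by (simp add: mult_simps(1-6) cancel X_def Y_def)
  have "d2 (?l (\<lambda>\<xi> \<eta>. Y \<xi> \<eta> - X \<xi> \<eta>)) x t = d1 (?l (\<lambda>\<xi> \<eta>. - (X \<xi> \<eta> + Y \<xi> \<eta>))) x t" for x t
  proof -
    let ?\<xi> = "(x + t) / 2" and ?\<eta> = "(x - t) / 2"
    let ?M = "E 1 ?\<xi> ?\<eta> ** bracket (v ?\<xi> ?\<eta>) a ** adj (E 1 ?\<xi> ?\<eta>)"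
    \<comment> \<open>The other two partial derivatives enter both sides of the wave equation in the
      same way, so their existence is enough.\<close>
    obtain X1 where X1: "((\<lambda>y. X y ?\<eta>) has_vector_derivative X1) (at ?\<xi>)"
      using smooth2_partials[OF smooth(2)] by metis
    obtain Y2 where Y2: "((\<lambda>y. Y ?\<xi> y) has_vector_derivative Y2) (at ?\<eta>)"
      using smooth2_partials[OF smooth(3)] by metis
    have XY: "smooth2 (\<lambda>\<xi> \<eta>. X \<xi> \<eta> + Y \<xi> \<eta>)" using smooth by (intro smooth2_add)
    have "smooth2 (\<lambda>\<xi> \<eta>. Y \<xi> \<eta> - X \<xi> \<eta>)" using smooth by (intro smooth2_diff)
    then have "d2 (?l (\<lambda>\<xi> \<eta>. Y \<xi> \<eta> - X \<xi> \<eta>)) x t = (1 / 2) *\<^sub>R ((- ?M - X1) - (Y2 - ?M))"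
      unfolding d2_def
      by (intro vector_derivative_at lightcone_derivatives(2) has_vector_derivative_diff X1 Y2 X2 Y1)
    moreover have "d1 (?l (\<lambda>\<xi> \<eta>. - (X \<xi> \<eta> + Y \<xi> \<eta>))) x t = - ((1 / 2) *\<^sub>R ((X1 + - ?M) + (?M + Y2)))"
      unfolding d1_def using XY
      by (intro vector_derivative_at has_vector_derivative_minus lightcone_derivatives(1)
          has_vector_derivative_add X1 Y2 X2 Y1)
    moreover have "(1 / 2) *\<^sub>R ((- ?M - X1) - (Y2 - ?M)) = - ((1 / 2) *\<^sub>R ((X1 + - ?M) + (?M + Y2)))"
      by (simp add: algebra_simps)
    ultimately show ?thesis by (simp only:)
  qed
  then show ?thesis
    unfolding S wave_map_def D1 D2 using SU smooth2_lightcone[OF smooth(1)] by (auto simp: fun_eq_iff)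
qed

section \<open>Pairs of poles symmetric about the imaginary axis\<close>

text \<open>Applied below with \<open>w = cnj z\<close> and second pole \<open>- w\<close>; then
  \<open>N2\<close> is \<open>transpose q1\<close> pulled back by the first factor, and
  \<open>g2 l ** g1 l\<close> inverts the product of the two right factors. Independent
  \<open>z\<close> and \<open>w\<close> make the claim an identity of rational functions.\<close>

lemma symmetric_pair_frame:
  fixes q1 :: cmat
  assumes q1: "q1 ** q1 = q1" "trace q1 = 1" "det q1 = 0" and zw: "z + w \<noteq> 0"
  defines "N2 \<equiv> simple_factor q1 (2 * z / (z + w)) ** transpose q1 ** simple_factor q1 (2 * w / (z + w))"
  assumes t: "trace N2 \<noteq> 0"
  defines "q2 \<equiv> normalize_trace N2"
  assumes l: "l \<noteq> z" "l \<noteq> - z" "l \<noteq> w" "l \<noteq> - w"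
  defines "g1 \<equiv> \<lambda>l. simple_factor q1 ((l - z) / (l - w))" and "g2 \<equiv> \<lambda>l. simple_factor q2 ((l + w) / (l + z))"
  shows "transpose (g2 (- l) ** g1 (- l)) ** (g2 l ** g1 l) = mat 1"
proof -
  define \<alpha> where "\<alpha> = q1$1$1"
  define \<beta> where "\<beta> = q1$1$2"
  define \<gamma> where "\<gamma> = q1$2$1"
  have q22: "q1$2$2 = 1 - \<alpha>" using q1(2) by (simp add: trace_2 \<alpha>_def algebra_simps)
  \<comment> \<open>Trace 1 and determinant 0 leave three letters with this one relation, from which
    \<open>algebra\<close> derives \<open>R1\<close> and \<open>R2\<close>.\<close>
  have rel: "\<beta> * \<gamma> = \<alpha> - \<alpha> * \<alpha>"
    using q1(3) q22 by (simp add: det_2 \<alpha>_def \<beta>_def \<gamma>_def algebra_simps)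
  note q1e = \<alpha>_def[symmetric] \<beta>_def[symmetric] \<gamma>_def[symmetric] q22
  \<comment> \<open>Clearing the denominators \<open>z + w\<close> keeps the identities polynomial;
    the normalisation of the trace discards the scalar anyway.\<close>
  define M where "M = ((2 * z) \<cdot>\<^sub>M mat 1 - (z - w) \<cdot>\<^sub>M q1) ** transpose q1 ** ((2 * w) \<cdot>\<^sub>M mat 1 + (z - w) \<cdot>\<^sub>M q1)"
  define \<tau> where "\<tau> = trace M"
  have sf: "simple_factor q1 (2 * x / (z + w)) = inverse (z + w) \<cdot>\<^sub>M ((2 * x) \<cdot>\<^sub>M mat 1 + (z + w - 2 * x) \<cdot>\<^sub>M q1)" for x
    using zw by (simp add: simple_factor_def cmat_eq_iff mat_nth field_simps)
  have N2M: "N2 = (inverse (z + w) * inverse (z + w)) \<cdot>\<^sub>M M"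
    unfolding N2_def sf M_def by (simp add: mult_simps mscale_simps) (simp add: cmat_eq_iff algebra_simps)
  have \<tau>0: "\<tau> \<noteq> 0" using t by (auto simp: N2M trace_mscale \<tau>_def)
  have q2: "q2 = inverse \<tau> \<cdot>\<^sub>M M"
    unfolding q2_def N2M using zw by (subst normalize_trace_scale) (auto simp: normalize_trace_def \<tau>_def)
  define R where "R l = (((l + w) * \<tau>) \<cdot>\<^sub>M mat 1 + (z - w) \<cdot>\<^sub>M M) ** ((l - z) \<cdot>\<^sub>M mat 1 + (z - w) \<cdot>\<^sub>M q1)" for l
  txt \<open>\<open>R\<close> is the product of the two factors with denominators cleared; by the next two facts the
    transpose of \<open>R (- l)\<close> is the adjugate of \<open>R l\<close>.\<close>
  have R1: "R (- l) $ 1 $ 1 = R l $ 2 $ 2" for l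
    unfolding R_def \<tau>_def M_def using rel
    by (simp add: mult_nth trace_2 mat_nth q1e) algebra
  have R2: "R (- l) $ 2 $ 1 = - R l $ 1 $ 2" for l
    unfolding R_def \<tau>_def M_def using rel
    by (simp add: mult_nth trace_2 mat_nth q1e) algebra
  define \<kappa> where "\<kappa> l = inverse (l + z) * inverse \<tau> * inverse (l - w)" for l
  have G: "g2 l ** g1 l = \<kappa> l \<cdot>\<^sub>M R l" if "l \<noteq> w" "l \<noteq> - z" for l
  proof -
    have lz: "l + z \<noteq> 0" "l - w \<noteq> 0" using that by (auto simp: add_eq_0_iff2)
    have "g1 l = inverse (l - w) \<cdot>\<^sub>M ((l - z) \<cdot>\<^sub>M mat 1 + (z - w) \<cdot>\<^sub>M q1)"
      using lz by (simp add: g1_def simple_factor_def cmat_eq_iff mat_nth field_simps)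
    moreover have "g2 l = (inverse (l + z) * inverse \<tau>) \<cdot>\<^sub>M (((l + w) * \<tau>) \<cdot>\<^sub>M mat 1 + (z - w) \<cdot>\<^sub>M M)"
    proof -
      have "1 - (l + w) / (l + z) = (z - w) * inverse (l + z)" using lz by (simp add: field_simps)
      then have c: "(l + w) / (l + z) = inverse (l + z) * inverse \<tau> * ((l + w) * \<tau>)"
        "(1 - (l + w) / (l + z)) * inverse \<tau> = inverse (l + z) * inverse \<tau> * (z - w)"
        using \<tau>0 by (simp_all add: divide_inverse)
      have "g2 l = ((l + w) / (l + z)) \<cdot>\<^sub>M mat 1 + ((1 - (l + w) / (l + z)) * inverse \<tau>) \<cdot>\<^sub>M M"
        by (simp add: g2_def q2 simple_factor_def cmat_eq_iff algebra_simps)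
      then show ?thesis unfolding c(2) unfolding c(1) by (simp only: mscale_simps)
    qed
    ultimately show ?thesis
      by (simp only: R_def \<kappa>_def mult_simps(7,8) mscale_simps(4) mult.assoc mult.commute mult.left_commute)
  qed
  have "det M = 0" by (simp add: M_def det_mul q1)
  then have "trace q2 = 1" "det q2 = 0"
    using \<tau>0 by (simp_all add: q2 trace_mscale \<tau>_def[symmetric] det_2 algebra_simps)
  then have "det (g2 l ** g1 l) = ((l + w) / (l + z)) * ((l - z) / (l - w))"
    by (simp add: det_mul g1_def g2_def simple_factor_det q1)
  then have dR: "\<kappa> l * \<kappa> l * det (R l) = ((l + w) / (l + z)) * ((l - z) / (l - w))"
    using G[OF l(3,2)] by (simp add: det_2 algebra_simps)
  have nz: "l + z \<noteq> 0" "l - w \<noteq> 0" "l - z \<noteq> 0" "l + w \<noteq> 0"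
    using l by (auto simp: add_eq_0_iff2)
  \<comment> \<open>The quotient of the scalars at \<open>- l\<close> and \<open>l\<close> is the
    reciprocal of the determinant of \<open>g2 l ** g1 l\<close>, which is what normalises the
    adjugate to the inverse.\<close>
  have "\<kappa> (- l) = \<kappa> l * (((l + z) / (l + w)) * ((l - w) / (l - z)))"
    using nz \<tau>0 minus_diff_eq[of l z] by (simp add: \<kappa>_def divide_simps) algebra
  then have "\<kappa> (- l) * \<kappa> l * det (R l) = (\<kappa> l * \<kappa> l * det (R l)) * (((l + z) / (l + w)) * ((l - w) / (l - z)))"
    by simp
  also have "\<dots> = 1" unfolding dR using nz by simp
  finally have one: "\<kappa> (- l) * \<kappa> l * det (R l) = 1" .
  have RR: "transpose (R (- l)) ** R l = det (R l) \<cdot>\<^sub>M mat 1"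
    using R1[of l] R1[of "- l"] R2[of l] R2[of "- l"]
    by (simp add: cmat_eq_iff mult_nth mat_nth det_2)
  have l': "- l \<noteq> w" "- l \<noteq> - z" using l by (auto simp: minus_equation_iff)
  have "transpose (\<kappa> (- l) \<cdot>\<^sub>M R (- l)) = \<kappa> (- l) \<cdot>\<^sub>M transpose (R (- l))"
    by (simp add: cmat_eq_iff)
  moreover have "\<kappa> l * (\<kappa> (- l) * det (R l)) = 1" using one by (simp only: mult_ac)
  ultimately show ?thesis
    unfolding G[OF l(3,2)] G[OF l'] using RR
    by (simp add: mult_simps mscale_simps)
qed

section \<open>Limits of normalised projections and simple factors\<close>

lemma tendsto_normalize_trace:
  assumes "(N \<longlongrightarrow> e) F" "trace e = 1"
  shows "((\<lambda>x. normalize_trace (N x)) \<longlongrightarrow> e) F"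
proof -
  have "((\<lambda>x. inverse (trace (N x))) \<longlongrightarrow> inverse (trace e)) F"
    using assms by (intro tendsto_inverse bounded_linear.tendsto[OF bounded_linear_trace]) auto
  from bounded_bilinear.tendsto[OF bounded_bilinear_mscale this assms(1)] assms(2)
  show ?thesis by (simp add: normalize_trace_def mscale_simps)
qed

lemma tendsto_simple_factor:
  assumes "(q \<longlongrightarrow> e) F"
  shows "((\<lambda>x. simple_factor (q x) c) \<longlongrightarrow> simple_factor e c) F"
  unfolding simple_factor_def
  by (intro tendsto_add tendsto_diff tendsto_const assms bounded_bilinear.tendsto[OF bounded_bilinear_mscale])

section \<open>Products of simple factors\<close>

text \<open>With \<open>P j = adj (E\<^sub>0 (z j)) ** p ** E\<^sub>0 (z j)\<close> for the seed frame \<open>E\<^sub>0\<close>, this is the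
  space-time dependent right factor of the frame dressed \<open>n\<close> times.\<close>

primrec right_factor :: "(nat \<Rightarrow> complex) \<Rightarrow> (nat \<Rightarrow> cmat) \<Rightarrow> nat \<Rightarrow> complex \<Rightarrow> cmat" where
  "right_factor z P 0 l = mat 1"
| "right_factor z P (Suc n) l = right_factor z P n l **
     simple_factor (normalize_trace (adj (right_factor z P n (z (Suc n))) ** P (Suc n) ** right_factor z P n (z (Suc n))))
       (blaschke (cnj (z (Suc n))) l)"

text \<open>Each \<open>P j\<close> enters only through a trace-normalised matrix. This freedom is
  used to replace unbounded \<open>P j\<close> by convergent multiples.\<close>

lemma right_factor_scale:
  assumes "\<And>j. c j \<noteq> 0"
  shows "right_factor z (\<lambda>j. c j \<cdot>\<^sub>M P j) n l = right_factor z P n l"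
proof (induction n arbitrary: l)
  case (Suc n)
  have "adj H ** (c (Suc n) \<cdot>\<^sub>M P (Suc n)) ** H = c (Suc n) \<cdot>\<^sub>M (adj H ** P (Suc n) ** H)" for H
    by (simp add: mult_simps)
  then show ?case using Suc assms by (simp add: normalize_trace_scale)
qed simp

text \<open>In the limit every factor is a function of the same projection \<open>e\<close>. Pulling
  \<open>e\<close> back by such a factor gives \<open>e\<close> again, so all normalised projections
  tend to \<open>e\<close> and the scalars multiply.\<close>

lemma right_factor_tendsto:
  assumes e: "rank_one_projection e" and P: "\<And>j. j \<in> {1..n} \<Longrightarrow> ((\<lambda>x. P x j) \<longlongrightarrow> e) F"
  shows "((\<lambda>x. right_factor z (P x) n l) \<longlongrightarrow> simple_factor e (\<Prod>j\<in>{1..n}. blaschke (cnj (z j)) l)) F"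
  using P
proof (induction n arbitrary: l)
  case (Suc n)
  note eD = rank_one_projectionD[OF e]
  have IH: "((\<lambda>x. right_factor z (P x) n l) \<longlongrightarrow> simple_factor e (\<Prod>j\<in>{1..n}. blaschke (cnj (z j)) l)) F" for l
    using Suc by auto
  \<comment> \<open>The value of this scalar does not matter, since \<open>e\<close> absorbs simple
    factors built on itself.\<close>
  let ?c = "\<Prod>j\<in>{1..n}. blaschke (cnj (z j)) (z (Suc n))"
  have "((\<lambda>x. adj (right_factor z (P x) n (z (Suc n))) ** P x (Suc n) ** right_factor z (P x) n (z (Suc n)))
      \<longlongrightarrow> adj (simple_factor e ?c) ** e ** simple_factor e ?c) F"
    using Suc.prems by (intro bounded_bilinear.tendsto[OF bounded_bilinear_matrix_mult] bounded_linear.tendsto[OF bounded_linear_adj] IH) auto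
  moreover have "adj (simple_factor e ?c) ** e ** simple_factor e ?c = e"
    by (simp add: simple_factor_adj eD simple_factor_absorb)
  ultimately have "((\<lambda>x. right_factor z (P x) (Suc n) l) \<longlongrightarrow>
      simple_factor e (\<Prod>j\<in>{1..n}. blaschke (cnj (z j)) l) ** simple_factor e (blaschke (cnj (z (Suc n))) l)) F"
    unfolding right_factor.simps
    by (intro bounded_bilinear.tendsto[OF bounded_bilinear_matrix_mult] IH tendsto_simple_factor tendsto_normalize_trace)
       (use eD in auto)
  then show ?case by (simp add: simple_factor_mult eD)
qed simp

section \<open>Sequences of distinct poles in the upper half plane\<close>

definition poles :: "(nat \<Rightarrow> complex) \<Rightarrow> nat \<Rightarrow> complex set" where
  "poles z n = z ` {1..n} \<union> (\<lambda>j. cnj (z j)) ` {1..n}"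

lemma poles_0 [simp]: "poles z 0 = {}"
  by (simp add: poles_def)

lemma poles_Suc: "poles z (Suc n) = insert (z (Suc n)) (insert (cnj (z (Suc n))) (poles z n))"
  by (auto simp: poles_def atLeastAtMostSuc_conv)

lemma cnj_poles: "cnj l \<in> poles z n \<longleftrightarrow> l \<in> poles z n"
proof -
  have "cnj a = b \<longleftrightarrow> a = cnj b" for a b by (metis complex_cnj_cnj)
  then show ?thesis by (auto simp: poles_def image_iff)
qed

locale pole_sequence =
  fixes z :: "nat \<Rightarrow> complex" and N :: nat
  assumes Im_pos: "j \<in> {1..N} \<Longrightarrow> 0 < Im (z j)" and inj: "inj_on z {1..N}"
begin

text \<open>Injectivity rules out the earlier \<open>z j\<close>, the half plane rules out their
  conjugates. So a frame or right factor is never evaluated at one of its own poles.\<close>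

lemma new_pole:
  assumes "Suc n \<le> N"
  shows "z (Suc n) \<notin> poles z n"
proof
  assume "z (Suc n) \<in> poles z n"
  then obtain j where j: "j \<in> {1..n}" "z (Suc n) = z j \<or> z (Suc n) = cnj (z j)"
    by (auto simp: poles_def)
  then have "z (Suc n) \<noteq> z j"
    using inj_onD[OF inj, of "Suc n" j] assms by auto
  moreover have "0 < Im (z (Suc n))" "0 < Im (z j)" using Im_pos assms j by auto
  ultimately show False using j by auto
qed

lemma real_not_pole:
  assumes "Im l = 0" "n \<le> N"
  shows "l \<notin> poles z n"
proof
  assume "l \<in> poles z n"
  then obtain j where "j \<in> {1..n}" "l = z j \<or> l = cnj (z j)" by (auto simp: poles_def)
  then show False using Im_pos[of j] assms by auto
qed

text \<open>The two claims feed each other: the reality condition at stage n makes the right factor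
  invertible at the next pole, so the pullback there has rank one; the resulting projection gives
  the reality condition at stage n + 1.\<close>

lemma right_factor_unitary:
  assumes p: "rank_one_projection p" and P: "\<And>j. \<exists>E F. F ** E = mat 1 \<and> P j = adj E ** p ** E"
  shows "n \<le> N \<Longrightarrow> l \<notin> poles z n \<Longrightarrow> adj (right_factor z P n (cnj l)) ** right_factor z P n l = mat 1"
    "Suc n \<le> N \<Longrightarrow> Q = adj (right_factor z P n (z (Suc n))) ** P (Suc n) ** right_factor z P n (z (Suc n)) \<Longrightarrow>
       adj Q = Q \<and> det Q = 0 \<and> trace Q \<noteq> 0 \<and> rank_one_projection (normalize_trace Q)"
proof -
  let ?H = "right_factor z P"
  have Q: "adj Q = Q \<and> det Q = 0 \<and> trace Q \<noteq> 0 \<and> rank_one_projection (normalize_trace Q)"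
    if H: "adj (?H n (cnj (z (Suc n)))) ** ?H n (z (Suc n)) = mat 1"
    and "Q = adj (?H n (z (Suc n))) ** P (Suc n) ** ?H n (z (Suc n))" for Q n
  proof -
    obtain E F where EF: "F ** E = mat 1" "P (Suc n) = adj E ** p ** E" using P by metis
    have "(adj (?H n (cnj (z (Suc n)))) ** F) ** (E ** ?H n (z (Suc n))) =
      adj (?H n (cnj (z (Suc n)))) ** (F ** E) ** ?H n (z (Suc n))" by (simp add: matrix_mul_assoc)
    then have "(adj (?H n (cnj (z (Suc n)))) ** F) ** (E ** ?H n (z (Suc n))) = mat 1" using EF H by simp
    from pullback_projection[OF p this] show ?thesis
      by (simp add: that(2) EF(2) adj_simps matrix_mul_assoc)
  qed
  have U: "n \<le> N \<Longrightarrow> l \<notin> poles z n \<Longrightarrow> adj (?H n (cnj l)) ** ?H n l = mat 1" for n l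
  proof (induction n arbitrary: l)
    case (Suc n)
    define q where "q = normalize_trace (adj (?H n (z (Suc n))) ** P (Suc n) ** ?H n (z (Suc n)))"
    have "rank_one_projection q"
      unfolding q_def using Q Suc.IH new_pole Suc.prems(1) by simp
    note qD = rank_one_projectionD[OF this]
    let ?w = "z (Suc n)"
    have l: "l \<notin> poles z n" "l \<noteq> ?w" "l \<noteq> cnj ?w" using Suc.prems by (auto simp: poles_Suc)
    have "adj (?H (Suc n) (cnj l)) ** ?H (Suc n) l =
        simple_factor q (blaschke ?w l) ** (adj (?H n (cnj l)) ** ?H n l) ** simple_factor q (blaschke (cnj ?w) l)"
      by (simp add: q_def[symmetric] adj_simps simple_factor_adj qD blaschke_cnj matrix_mul_assoc)
    then show ?case
      using Suc l blaschke_inverse[OF l(2,3)] by (simp add: simple_factor_mult qD)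
  qed (simp add: adj_simps)
  show "n \<le> N \<Longrightarrow> l \<notin> poles z n \<Longrightarrow> adj (?H n (cnj l)) ** ?H n l = mat 1" by (rule U)
  show "Suc n \<le> N \<Longrightarrow> Q = adj (?H n (z (Suc n))) ** P (Suc n) ** ?H n (z (Suc n)) \<Longrightarrow>
       adj Q = Q \<and> det Q = 0 \<and> trace Q \<noteq> 0 \<and> rank_one_projection (normalize_trace Q)"
    using Q U new_pole by simp
qed

end

locale symmetric_pole_sequence = pole_sequence z "2 * k" for z k +
  assumes pairs: "j \<in> {1..k} \<Longrightarrow> z (2 * j) = - cnj (z (2 * j - 1))"
begin

text \<open>If \<open>u + cnj u\<close> were 0 for the first pole \<open>u\<close> of a pair, the
  second pole \<open>- cnj u\<close> would coincide with it, against injectivity.\<close>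

lemma pair:
  assumes "Suc j \<le> k"
  shows "z (Suc (Suc (2 * j))) = - cnj (z (Suc (2 * j)))" "0 < Im (z (Suc (2 * j)))"
    "z (Suc (2 * j)) + cnj (z (Suc (2 * j))) \<noteq> 0"
proof -
  show *: "z (Suc (Suc (2 * j))) = - cnj (z (Suc (2 * j)))"
    using pairs[of "Suc j"] assms by simp
  show "0 < Im (z (Suc (2 * j)))" using Im_pos assms by auto
  have "z (Suc (Suc (2 * j))) \<noteq> z (Suc (2 * j))"
    using inj_onD[OF inj, of "Suc (Suc (2 * j))" "Suc (2 * j)"] assms by auto
  then show "z (Suc (2 * j)) + cnj (z (Suc (2 * j))) \<noteq> 0"
    unfolding * by (metis add.inverse_unique add.commute)
qed

text \<open>Induction over pairs. At the two poles of a new pair the earlier right factors are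
  entrywise conjugates of each other, so the matrix pulled back to the second pole is the transpose
  of the one at the first. This is the situation of \<open>symmetric_pair_frame\<close>.\<close>

lemma right_factor_symmetric:
  assumes p: "rank_one_projection p" and P: "\<And>j. \<exists>E F. F ** E = mat 1 \<and> P j = adj E ** p ** E"
    and tr: "\<And>j. j \<in> {1..k} \<Longrightarrow> P (2 * j) = transpose (P (2 * j - 1))"
    and j: "j \<le> k" and l: "l \<notin> poles z (2 * j)"
  shows "transpose (right_factor z P (2 * j) (- l)) ** right_factor z P (2 * j) l = mat 1"
  using j l
proof (induction j arbitrary: l)
  case (Suc j)
  let ?H = "right_factor z P (2 * j)"
  note U = right_factor_unitary[where P = P, OF p P]
  define u where "u = z (Suc (2 * j))"
  note pr = pair[OF Suc.prems(1), folded u_def]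
  have u0: "u \<notin> poles z (2 * j)" using new_pole[of "2 * j"] Suc.prems by (simp add: u_def)
  define N1 where "N1 = adj (?H u) ** P (Suc (2 * j)) ** ?H u"
  have N1: "adj N1 = N1" "det N1 = 0" "trace N1 \<noteq> 0" "rank_one_projection (normalize_trace N1)"
    using U(2)[of "2 * j" N1] Suc.prems by (auto simp: N1_def u_def)
  define q1 where "q1 = normalize_trace N1"
  note q1D = rank_one_projectionD[OF N1(4), folded q1_def]
  define H1 where "H1 = right_factor z P (Suc (2 * j))"
  have H1: "H1 l = ?H l ** simple_factor q1 (blaschke (cnj u) l)" for l
    by (simp add: H1_def q1_def N1_def u_def)
  define N2 where "N2 = adj (H1 (- cnj u)) ** P (Suc (Suc (2 * j))) ** H1 (- cnj u)"
  have N2: "trace N2 \<noteq> 0"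
    using U(2)[of "Suc (2 * j)" N2] Suc.prems pr(1) by (auto simp: N2_def H1_def)
  define q2 where "q2 = normalize_trace N2"
  have H2: "right_factor z P (2 * Suc j) l = ?H l ** (simple_factor q1 (blaschke (cnj u) l) ** simple_factor q2 (blaschke (- u) l))" for l
  proof -
    have "right_factor z P (2 * Suc j) l = H1 l ** simple_factor q2 (blaschke (- u) l)"
      using pr(1) by (simp add: H1_def q2_def N2_def del: right_factor.simps(2)) (simp add: H1_def[symmetric])
    then show ?thesis by (simp add: H1 matrix_mul_assoc)
  qed
  \<comment> \<open>The scalar of the first factor at the second pole
    \<open>- cnj u\<close>.\<close>
  define c where "c = 2 * cnj u / (u + cnj u)"
  have uu: "u + cnj u \<noteq> 0" by (rule pr(3))
  have bc: "blaschke (cnj u) (- cnj u) = c"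
  proof -
    have "- cnj u - cnj (cnj u) = - (u + cnj u)" "- cnj u - cnj u = - (2 * cnj u)" by simp_all
    then show ?thesis unfolding blaschke_def c_def by (simp only: minus_divide_divide)
  qed
  \<comment> \<open>The induction hypothesis and the reality condition, both at
    \<open>cnj u\<close>, exhibit inverses of the same matrix.\<close>
  have Hc: "?H (- cnj u) = transpose (adj (?H u))"
  proof -
    have "transpose (?H (- cnj u)) ** ?H (cnj u) = mat 1"
      using Suc u0 by (simp add: cnj_poles)
    moreover have "?H (cnj u) ** adj (?H u) = mat 1"
      using U(1)[of "2 * j" "cnj u"] u0 Suc.prems by (simp add: cnj_poles matrix_left_right_inverse)
    ultimately have "transpose (?H (- cnj u)) = adj (?H u)"
      by (metis matrix_mul_assoc matrix_mul_lid matrix_mul_rid)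
    then show ?thesis by (metis transpose_transpose)
  qed
  have "P (Suc (Suc (2 * j))) = transpose (P (Suc (2 * j)))"
    using tr[of "Suc j"] Suc.prems by simp
  moreover have "adj (transpose (adj (?H u))) = transpose (?H u)" by (simp add: cmat_eq_iff)
  ultimately have tN: "adj (?H (- cnj u)) ** P (Suc (Suc (2 * j))) ** ?H (- cnj u) = transpose N1"
    by (simp add: Hc N1_def matrix_transpose_mul matrix_mul_assoc)
  have "N1 = trace N1 \<cdot>\<^sub>M q1" using N1(3) by (simp add: q1_def normalize_trace_def mscale_simps)
  then have tN1: "transpose N1 = trace N1 \<cdot>\<^sub>M transpose q1" by (simp add: cmat_eq_iff)
  define N2' where "N2' = simple_factor q1 (2 * u / (u + cnj u)) ** transpose q1 ** simple_factor q1 (2 * cnj u / (u + cnj u))"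
  have "N2 = adj (simple_factor q1 c) ** (adj (?H (- cnj u)) ** P (Suc (Suc (2 * j))) ** ?H (- cnj u)) ** simple_factor q1 c"
    by (simp add: N2_def H1 bc adj_simps matrix_mul_assoc)
  then have N2': "N2 = trace N1 \<cdot>\<^sub>M N2'"
    unfolding tN tN1 by (simp add: N2'_def c_def simple_factor_adj q1D mult_simps add.commute)
  have q2: "q2 = normalize_trace N2'" "trace N2' \<noteq> 0"
    using N2 N1(3) by (auto simp: q2_def N2' normalize_trace_scale trace_mscale)
  have ld: "l \<noteq> u" "l \<noteq> - u" "l \<noteq> cnj u" "l \<noteq> - cnj u" "l \<notin> poles z (2 * j)"
    using Suc.prems(2) pr(1) by (auto simp: poles_Suc u_def[symmetric])
  \<comment> \<open>\<open>G\<close> has the factors of \<open>h\<close> in reverse order with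
    reciprocal scalars, hence is its inverse; this is the form treated by
    \<open>symmetric_pair_frame\<close>.\<close>
  define G where "G l = simple_factor q2 ((l + cnj u) / (l + u)) ** simple_factor q1 ((l - u) / (l - cnj u))" for l
  define h where "h l = simple_factor q1 (blaschke (cnj u) l) ** simple_factor q2 (blaschke (- u) l)" for l
  have GG: "transpose (G (- l)) ** G l = mat 1"
    unfolding G_def q2(1) N2'_def
    by (rule symmetric_pair_frame[OF q1D(1,3,4) uu]) (use q2(2) ld in \<open>auto simp: N2'_def\<close>)
  have r2: "rank_one_projection q2"
    using U(2)[of "Suc (2 * j)" N2] Suc.prems pr(1) by (auto simp: N2_def H1_def q2_def)
  note q2D = rank_one_projectionD[OF r2]
  have Gh: "G l ** h l = mat 1" if "l \<noteq> u" "l \<noteq> - u" "l \<noteq> cnj u" "l \<noteq> - cnj u" for l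
  proof -
    have nz: "l + u \<noteq> 0" "l + cnj u \<noteq> 0" using that by (auto simp: add_eq_0_iff2)
    have "G l ** h l = simple_factor q2 ((l + cnj u) / (l + u)) **
      (simple_factor q1 ((l - u) / (l - cnj u)) ** simple_factor q1 (blaschke (cnj u) l)) ** simple_factor q2 (blaschke (- u) l)"
      by (simp add: G_def h_def matrix_mul_assoc)
    also have "\<dots> = mat 1"
      using that nz by (simp add: simple_factor_mult q1D q2D blaschke_def)
    finally show ?thesis .
  qed
  have "transpose (h (- l)) = G l"
  proof -
    have "- l \<noteq> u" "- l \<noteq> - u" "- l \<noteq> cnj u" "- l \<noteq> - cnj u" using ld by (metis minus_minus)+
    from Gh[OF this] have "transpose (h (- l)) ** transpose (G (- l)) = mat 1"
      by (metis matrix_transpose_mul transpose_mat)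
    then show ?thesis using GG by (metis matrix_mul_assoc matrix_mul_lid matrix_mul_rid)
  qed
  then have hh: "transpose (h (- l)) ** h l = mat 1" using Gh ld by simp
  have "transpose (right_factor z P (2 * Suc j) (- l)) ** right_factor z P (2 * Suc j) l
     = transpose (h (- l)) ** (transpose (?H (- l)) ** ?H l) ** h l"
    unfolding H2 h_def[symmetric] by (simp add: matrix_transpose_mul matrix_mul_assoc)
  then show ?case using Suc ld hh by simp
qed (simp add: transpose_mat)

text \<open>For u on the unit circle and l = 1 or l = -1, the numerator (l - u)(l + cnj u) is -l (u
  - cnj u) and the denominator (l - cnj u)(l + u) is l (u - cnj u). Each pair therefore contributes
  -1.\<close>

lemma prod_blaschke_unimodular:
  assumes cm: "\<And>j. j \<in> {1..2 * k} \<Longrightarrow> cmod (z j) = 1" and l: "l = 1 \<or> l = - 1"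
  shows "j \<le> k \<Longrightarrow> (\<Prod>i\<in>{1..2 * j}. blaschke (z i) l) = (- 1) ^ j"
proof (induction j)
  case (Suc j)
  define u where "u = z (Suc (2 * j))"
  note pr = pair[OF Suc.prems, folded u_def]
  have "cmod u = 1" using cm Suc.prems by (simp add: u_def)
  then have uu: "u * cnj u = 1" using complex_norm_square[of u] by simp
  have "l * l = 1" using l by auto
  have r: "u \<noteq> of_real x" "cnj u \<noteq> of_real x" for x using pr(2) by (auto simp: complex_eq_iff)
  have "l - cnj u \<noteq> 0" "l + u \<noteq> 0"
    using l r[of 1] r[of "-1"] by (auto simp: add_eq_0_iff2 minus_equation_iff)
  moreover have "(l - u) * (l + cnj u) = - ((l - cnj u) * (l + u))"
    using uu \<open>l * l = 1\<close> by algebra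
  ultimately have "blaschke u l * blaschke (- cnj u) l = - 1"
    by (simp add: blaschke_def divide_simps)
  then show ?case using Suc pr(1) by (simp add: u_def mult.assoc)
qed simp

end

section \<open>The vacuum and its dressings\<close>

lemma diag2_simps:
  "diag2 a b ** diag2 c d = diag2 (a * c) (b * d)" "adj (diag2 a b) = diag2 (cnj a) (cnj b)"
  "transpose (diag2 a b) = diag2 a b" "diag2 1 1 = mat 1" "- diag2 a b = diag2 (- a) (- b)"
  "c \<cdot>\<^sub>M diag2 a b = diag2 (c * a) (c * b)" "x *\<^sub>R diag2 a b = diag2 (x *\<^sub>R a) (x *\<^sub>R b)"
  by (simp_all add: cmat_eq_iff mult_nth mat_nth)

lemma diag2_split: "diag2 c d = diag2 c 0 + diag2 0 d"
  by (simp add: cmat_eq_iff)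

lemma mat_exp_diag2: "mat_exp (diag2 c d) = diag2 (exp c) (exp d)"
proof -
  have pow: "((**) (diag2 c d) ^^ n) (mat 1) = diag2 (c ^ n) (d ^ n)" for n
    by (induction n) (simp_all add: diag2_simps)
  have "(\<lambda>n. diag2 (c ^ n /\<^sub>R fact n) 0) sums diag2 (exp c) 0"
    "(\<lambda>n. diag2 0 (d ^ n /\<^sub>R fact n)) sums diag2 0 (exp d)"
    by (intro bounded_linear.sums[OF bounded_linear_diag2(1)] bounded_linear.sums[OF bounded_linear_diag2(2)] exp_converges)+
  from sums_add[OF this] have "(\<lambda>n. diag2 (c ^ n /\<^sub>R fact n) (d ^ n /\<^sub>R fact n)) sums diag2 (exp c) (exp d)"
    by (simp only: diag2_split[symmetric])
  then show ?thesis
    unfolding mat_exp_def pow diag2_simps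
    by (simp add: sums_iff inverse_eq_divide)
qed

definition vacuum_frame :: "real \<Rightarrow> complex \<Rightarrow> real \<Rightarrow> real \<Rightarrow> cmat" where
  "vacuum_frame m l \<xi> \<eta> = (let w = \<i> * m * (l * \<xi> + inverse l * \<eta>) in diag2 (exp w) (exp (- w)))"

lemma smooth2_diag2:
  assumes "\<And>n. Ck n (\<lambda>p. f (fst p) (snd p))" "\<And>n. Ck n (\<lambda>p. g (fst p) (snd p))"
  shows "smooth2 (\<lambda>x t. diag2 (f x t) (g x t))"
  unfolding smooth2_iff
  by (subst diag2_split) (intro allI Ck_add Ck_bounded_linear[OF bounded_linear_diag2(1)]
        Ck_bounded_linear[OF bounded_linear_diag2(2)] assms)

lemma smooth2_vacuum_frame: "smooth2 (vacuum_frame m l)"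
proof -
  have lin: "Ck n (\<lambda>p. c * (l * complex_of_real (fst p) + inverse l * complex_of_real (snd p)))" for n c
  proof -
    have "linear (\<lambda>p. c * (l * complex_of_real (fst p) + inverse l * complex_of_real (snd p)))"
      by (auto intro!: linearI simp: scaleR_conv_of_real algebra_simps)
    then show ?thesis by (intro Ck_bounded_linear[OF _ Ck_ident]) (simp add: linear_conv_bounded_linear)
  qed
  have "smooth2 (\<lambda>\<xi> \<eta>. diag2 (exp ((\<i> * m) * (l * \<xi> + inverse l * \<eta>))) (exp (- (\<i> * m) * (l * \<xi> + inverse l * \<eta>))))"
    by (intro smooth2_diag2 Ck_exp lin)
  then show ?thesis by (simp add: vacuum_frame_def[abs_def] Let_def)
qed

lemma flow_frame_vacuum:
  fixes m :: real
  assumes a: "a = diag2 (\<i> * complex_of_real m) (- \<i> * complex_of_real m)"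
  shows "flow_frame a (\<lambda>_ _. 0) (\<lambda>_ _. a) (vacuum_frame m) {}"
proof -
  have su: "a \<in> su2" "0 \<in> su2"
    by (simp_all add: su2_def a diag2_simps trace_2 adj_simps)
  have "minus_one_flow ((\<lambda>_ _. a), (\<lambda>_ _. 0), (\<lambda>_ _. a))"
    using su by (simp add: minus_one_flow_def bracket_def mult_simps)
  moreover have "lax_pair a (\<lambda>_ _. 0) (\<lambda>_ _. a) l (vacuum_frame m l)" if "l \<noteq> 0" for l
    unfolding lax_pair_def
  proof (intro conjI allI)
    show "vacuum_frame m l 0 0 = mat 1" by (simp add: vacuum_frame_def diag2_simps)
    have d: "((\<lambda>y. diag2 (exp (w y)) (exp (- w y))) has_vector_derivative diag2 (exp (w t) * w') (exp (- w t) * - w')) (at t)"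
      if w: "(w has_vector_derivative w') (at t)" for w w' t
    proof -
      have 1: "((\<lambda>y. exp (w y)) has_vector_derivative exp (w t) * w') (at t)"
        using field_vector_diff_chain_at[OF w DERIV_exp] by (simp add: o_def mult.commute)
      have 2: "((\<lambda>y. exp (- w y)) has_vector_derivative exp (- w t) * - w') (at t)"
        using field_vector_diff_chain_at[OF has_vector_derivative_minus[OF w] DERIV_exp] by (simp add: o_def mult.commute)
      show ?thesis
        by (subst (1 2) diag2_split) (intro has_vector_derivative_add
          bounded_linear.has_vector_derivative[OF bounded_linear_diag2(1)]
          bounded_linear.has_vector_derivative[OF bounded_linear_diag2(2)] 1 2)
    qed
    fix \<xi> \<eta>
    have "((\<lambda>y. \<i> * m * (l * complex_of_real y + inverse l * complex_of_real \<eta>)) has_vector_derivative \<i> * m * l) (at \<xi>)"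
      by (auto intro!: derivative_eq_intros simp: has_vector_derivative_def scaleR_conv_of_real fun_eq_iff)
    from d[OF this] show "((\<lambda>y. vacuum_frame m l y \<eta>) has_vector_derivative vacuum_frame m l \<xi> \<eta> ** (l \<cdot>\<^sub>M a + 0)) (at \<xi>)"
      unfolding vacuum_frame_def Let_def
      by (rule has_vector_derivative_eq_rhs) (simp add: a diag2_simps ac_simps)
    have "((\<lambda>y. \<i> * m * (l * complex_of_real \<xi> + inverse l * complex_of_real y)) has_vector_derivative \<i> * m * inverse l) (at \<eta>)"
      by (auto intro!: derivative_eq_intros simp: has_vector_derivative_def scaleR_conv_of_real fun_eq_iff)
    from d[OF this] show "((\<lambda>y. vacuum_frame m l \<xi> y) has_vector_derivative inverse l \<cdot>\<^sub>M (vacuum_frame m l \<xi> \<eta> ** a)) (at \<eta>)"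
      unfolding vacuum_frame_def Let_def
      by (rule has_vector_derivative_eq_rhs) (simp add: a diag2_simps ac_simps)
  qed
  moreover have "adj (vacuum_frame m (cnj l) \<xi> \<eta>) ** vacuum_frame m l \<xi> \<eta> = mat 1" for l \<xi> \<eta>
    by (simp add: vacuum_frame_def Let_def diag2_simps exp_cnj exp_add[symmetric])
  moreover have "det (vacuum_frame m l \<xi> \<eta>) = 1" for l \<xi> \<eta>
    by (simp add: vacuum_frame_def Let_def det_2 exp_add[symmetric])
  ultimately show ?thesis
    unfolding flow_frame_def using smooth2_const smooth2_vacuum_frame by auto
qed

primrec soliton_frame :: "(nat \<Rightarrow> complex) \<Rightarrow> cmat \<Rightarrow> (complex \<Rightarrow> real \<Rightarrow> real \<Rightarrow> cmat) \<Rightarrow> nat \<Rightarrow>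
    complex \<Rightarrow> real \<Rightarrow> real \<Rightarrow> cmat" where
  "soliton_frame z p E 0 = E"
| "soliton_frame z p E (Suc n) = dress (z (Suc n)) p (soliton_frame z p E n)"

lemma (in pole_sequence) flow_frame_soliton:
  assumes E: "flow_frame a u v E {}" and p: "rank_one_projection p"
  shows "n \<le> N \<Longrightarrow> \<exists>u' v'. backlund_seq z (\<lambda>_. p) ((\<lambda>_ _. a), u, v) n = ((\<lambda>_ _. a), u', v') \<and>
    flow_frame a u' v' (soliton_frame z p E n) (poles z n)"
proof (induction n)
  case 0
  show ?case using E by simp
next
  case (Suc n)
  then obtain u' v' where 1: "backlund_seq z (\<lambda>_. p) ((\<lambda>_ _. a), u, v) n = ((\<lambda>_ _. a), u', v')"
    "flow_frame a u' v' (soliton_frame z p E n) (poles z n)" by auto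
  have "Im (z (Suc n)) \<noteq> 0" using Im_pos[of "Suc n"] Suc.prems by auto
  from flow_frame_dress[OF 1(2) p this new_pole[OF Suc.prems]] show ?case
    by (simp add: 1(1) poles_Suc)
qed

text \<open>All left factors are built on the same constant \<open>p\<close>, so they merge into
  one. As \<open>p\<close> absorbs that factor, the pullback at the next pole involves only the seed
  frame and the right factor.\<close>

lemma soliton_frame_factor:
  assumes p: "rank_one_projection p"
  shows "soliton_frame z p E n l \<xi> \<eta> = simple_factor p (\<Prod>j\<in>{1..n}. blaschke (z j) l) ** E l \<xi> \<eta> **
    right_factor z (\<lambda>j. adj (E (z j) \<xi> \<eta>) ** p ** E (z j) \<xi> \<eta>) n l"
proof (induction n arbitrary: l)
  case (Suc n)
  note pD = rank_one_projectionD[OF p]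
  let ?S = "\<lambda>l. simple_factor p (\<Prod>j\<in>{1..n}. blaschke (z j) l)"
  let ?H = "right_factor z (\<lambda>j. adj (E (z j) \<xi> \<eta>) ** p ** E (z j) \<xi> \<eta>) n"
  have "adj (?S l ** E l \<xi> \<eta> ** ?H l) ** p ** (?S l ** E l \<xi> \<eta> ** ?H l) =
     adj (?H l) ** (adj (E l \<xi> \<eta>) ** (adj (?S l) ** p ** ?S l) ** E l \<xi> \<eta>) ** ?H l" for l
    by (simp add: adj_simps matrix_mul_assoc)
  moreover have "adj (?S l) ** p ** ?S l = p" for l
    by (simp add: simple_factor_adj pD simple_factor_absorb)
  ultimately have N: "adj (?S l ** E l \<xi> \<eta> ** ?H l) ** p ** (?S l ** E l \<xi> \<eta> ** ?H l) =
     adj (?H l) ** (adj (E l \<xi> \<eta>) ** p ** E l \<xi> \<eta>) ** ?H l" for l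
    by (simp only:)
  have "dress (z (Suc n)) p (soliton_frame z p E n) l \<xi> \<eta> =
     (simple_factor p (blaschke (z (Suc n)) l) ** ?S l) ** E l \<xi> \<eta> ** right_factor z (\<lambda>j. adj (E (z j) \<xi> \<eta>) ** p ** E (z j) \<xi> \<eta>) (Suc n) l"
    unfolding dress_def Suc N right_factor.simps by (simp only: matrix_mul_assoc)
  then show ?case by (simp add: simple_factor_mult pD mult.commute)
qed simp

section \<open>Limits in time\<close>

text \<open>Convergence of a function of (x, t) along \<open>filtercomap snd F\<close> is
  convergence uniform in x. The outer factors are bounded, so they preserve the null function
  \<open>M - 1\<close>.\<close>

lemma uniform_limit_conjugate:
  fixes A A' :: cmat and D :: "real \<Rightarrow> cmat" and M :: "real \<Rightarrow> real \<Rightarrow> cmat"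
  assumes M: "((\<lambda>p. M (fst p) (snd p)) \<longlongrightarrow> mat 1) (filtercomap snd F)"
    and D: "\<And>x. norm (D x) \<le> K"
  shows "uniform_limit UNIV (\<lambda>t x. A ** D x ** M x t ** D x ** A') (\<lambda>x. A ** D x ** D x ** A') F"
proof -
  let ?F = "filtercomap (snd :: real \<times> real \<Rightarrow> real) F"
  have Z: "Zfun (\<lambda>p. M (fst p) (snd p) - mat 1) ?F" using M by (simp add: tendsto_Zfun_iff)
  have B: "Bfun (\<lambda>p. D (fst p)) ?F" by (rule BfunI[of _ K]) (simp add: D)
  have B0: "Bfun (\<lambda>p. C) ?F" for C :: cmat by (rule BfunI[of _ "norm C"]) simp
  note bb = bounded_bilinear_matrix_mult
  have "Zfun (\<lambda>p. A ** (D (fst p) ** (M (fst p) (snd p) - mat 1) ** D (fst p) ** A')) ?F"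
    by (intro bounded_bilinear.Bfun_prod_Zfun[OF bb] bounded_bilinear.Zfun_prod_Bfun[OF bb] Z B B0)
  then have "((\<lambda>p. norm (A ** (D (fst p) ** (M (fst p) (snd p) - mat 1) ** D (fst p) ** A'))) \<longlongrightarrow> 0) ?F"
    by (simp add: tendsto_Zfun_iff Zfun_norm_iff)
  moreover have "A ** (D x ** (M x t - mat 1) ** D x ** A') = A ** D x ** M x t ** D x ** A' - A ** D x ** D x ** A'" for x t
    by (simp add: mult_simps)
  ultimately have T: "((\<lambda>p. dist (A ** D (fst p) ** M (fst p) (snd p) ** D (fst p) ** A') (A ** D (fst p) ** D (fst p) ** A')) \<longlongrightarrow> 0) ?F"
    by (simp add: dist_norm)
  show ?thesis
  proof (rule uniform_limitI)
    fix e :: real assume "e > 0"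
    from order_tendstoD(2)[OF T this]
    have "\<forall>\<^sub>F p in ?F. dist (A ** D (fst p) ** M (fst p) (snd p) ** D (fst p) ** A') (A ** D (fst p) ** D (fst p) ** A') < e" .
    \<comment> \<open>\<open>Q\<close> is a condition on t alone; this is where uniformity in x
      comes from.\<close>
    then obtain Q where Q: "eventually Q F"
      "\<And>p. Q (snd p) \<Longrightarrow> dist (A ** D (fst p) ** M (fst p) (snd p) ** D (fst p) ** A') (A ** D (fst p) ** D (fst p) ** A') < e"
      unfolding eventually_filtercomap by blast
    show "\<forall>\<^sub>F t in F. \<forall>x\<in>UNIV. dist (A ** D x ** M x t ** D x ** A') (A ** D x ** D x ** A') < e"
      using Q(1) by eventually_elim (use Q(2)[of "(_, _)"] in auto)
  qed
qed

lemma tendsto_cmat: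
  assumes "((\<lambda>x. f x $ 1 $ 1) \<longlongrightarrow> A $ 1 $ 1) F" "((\<lambda>x. f x $ 1 $ 2) \<longlongrightarrow> A $ 1 $ 2) F"
    "((\<lambda>x. f x $ 2 $ 1) \<longlongrightarrow> A $ 2 $ 1) F" "((\<lambda>x. f x $ 2 $ 2) \<longlongrightarrow> A $ 2 $ 2) F"
  shows "(f \<longlongrightarrow> (A :: cmat)) F"
proof (rule vec_tendstoI, rule vec_tendstoI)
  fix i j :: 2
  show "((\<lambda>x. f x $ i $ j) \<longlongrightarrow> A $ i $ j) F"
    using assms exhaust_2[of i] exhaust_2[of j] by auto
qed

text \<open>The pulled back projections grow exponentially in time, so the limit is taken for
  rescaled copies, which yield the same right factor.\<close>

lemma right_factor_tendsto_normalized: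
  fixes P :: "'a \<Rightarrow> nat \<Rightarrow> cmat"
  assumes e: "rank_one_projection e"
    and c: "\<And>x j. c x j \<noteq> 0" and P: "\<And>j. j \<in> {1..n} \<Longrightarrow> ((\<lambda>x. c x j \<cdot>\<^sub>M P x j) \<longlongrightarrow> e) F"
  shows "((\<lambda>x. right_factor z (P x) n l) \<longlongrightarrow> simple_factor e (\<Prod>j\<in>{1..n}. blaschke (cnj (z j)) l)) F"
proof -
  have "right_factor z (\<lambda>j. c x j \<cdot>\<^sub>M P x j) n l = right_factor z (P x) n l" for x
    by (rule right_factor_scale[OF c])
  then show ?thesis using right_factor_tendsto[OF e, of n "\<lambda>x j. c x j \<cdot>\<^sub>M P x j" F z l] P by simp
qed

section \<open>The projection onto the line spanned by (1, 1)\<close>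

definition half_ones :: cmat where
  "half_ones = (\<chi> i j. 1 / 2)"

lemma half_ones_nth [simp]: "half_ones $ i $ j = 1 / 2"
  by (simp add: half_ones_def)

lemma rank_one_half_ones: "rank_one_projection half_ones"
  by (simp add: rank_one_projection_def hermitian_projection_def cmat_simps)

lemma herm_proj_diagonal_line: "herm_proj (vec.span {vector [1, 1]}) = half_ones"
proof (rule herm_proj_eq)
  show "hermitian_projection half_ones"
    using rank_one_half_ones by (simp add: rank_one_projection_def)
  have mv: "half_ones *v x = ((x$1 + x$2) / 2) *s vector [1, 1]" for x
    by (simp add: vec_eq_iff forall_2 matrix_vector_mult_def sum_2 vector_2 field_simps)
  show "range ((*v) half_ones) = vec.span {vector [1, 1]}"
    unfolding vec.span_singleton
  proof (intro set_eqI iffI)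
    fix y assume "y \<in> range (\<lambda>k. k *s (vector [1, 1] :: complex^2))"
    then obtain k where "y = k *s vector [1, 1]" by auto
    then have "y = half_ones *v (k *s vector [1, 1])" by (simp add: mv vector_2)
    then show "y \<in> range ((*v) half_ones)" by blast
  qed (auto simp: mv)
qed

section \<open>Special values of the vacuum frame and its pulled back projections\<close>

lemma vacuum_frame_one:
  "vacuum_frame m (- 1) ((x + t) / 2) ((x - t) / 2) = diag2 (exp (- (\<i> * m * x))) (exp (\<i> * m * x))"
  "adj (vacuum_frame m 1 ((x + t) / 2) ((x - t) / 2)) = diag2 (exp (- (\<i> * m * x))) (exp (\<i> * m * x))"
proof -
  \<comment> \<open>Only \<xi> + \<eta> = x enters at these spectral values, so t drops out of the
    exponent.\<close>
  have w: "\<i> * m * (- 1 * complex_of_real ((x + t) / 2) + inverse (- 1) * complex_of_real ((x - t) / 2)) = - (\<i> * m * x)"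
    "\<i> * m * (1 * complex_of_real ((x + t) / 2) + inverse 1 * complex_of_real ((x - t) / 2)) = \<i> * m * x"
    by (simp_all add: field_simps)
  show "vacuum_frame m (- 1) ((x + t) / 2) ((x - t) / 2) = diag2 (exp (- (\<i> * m * x))) (exp (\<i> * m * x))"
    unfolding vacuum_frame_def Let_def w by simp
  show "adj (vacuum_frame m 1 ((x + t) / 2) ((x - t) / 2)) = diag2 (exp (- (\<i> * m * x))) (exp (\<i> * m * x))"
    unfolding vacuum_frame_def Let_def w by (simp add: diag2_simps exp_cnj)
qed

text \<open>The exponent at \<open>- cnj l\<close> is the complex conjugate of the exponent at
  \<open>l\<close>, and the frame is diagonal.\<close>

lemma vacuum_frame_reflect: "vacuum_frame m (- cnj l) \<xi> \<eta> = adj (vacuum_frame m l \<xi> \<eta>)"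
  by (simp add: vacuum_frame_def Let_def diag2_simps exp_cnj algebra_simps)

lemma vacuum_frame_unitary: "adj (vacuum_frame m (cnj l) \<xi> \<eta>) ** vacuum_frame m l \<xi> \<eta> = mat 1"
  by (simp add: vacuum_frame_def Let_def diag2_simps exp_cnj exp_add[symmetric])

definition vacuum_projector :: "real \<Rightarrow> complex \<Rightarrow> real \<Rightarrow> real \<Rightarrow> cmat" where
  "vacuum_projector m l x t = adj (vacuum_frame m l ((x + t) / 2) ((x - t) / 2)) ** half_ones **
     vacuum_frame m l ((x + t) / 2) ((x - t) / 2)"

text \<open>Reflection exchanges the frame with its adjoint; all three matrices in the product are
  symmetric, so transposition does the same.\<close>

lemma vacuum_projector_reflect:
  "vacuum_projector m (- cnj l) x t = transpose (vacuum_projector m l x t)"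
proof -
  have "transpose half_ones = half_ones" by (simp add: cmat_eq_iff)
  moreover have "transpose (vacuum_frame m l \<xi> \<eta>) = vacuum_frame m l \<xi> \<eta>"
    "transpose (adj (vacuum_frame m l \<xi> \<eta>)) = adj (vacuum_frame m l \<xi> \<eta>)" for \<xi> \<eta>
    by (simp_all add: vacuum_frame_def Let_def diag2_simps)
  ultimately show ?thesis
    by (simp add: vacuum_projector_def vacuum_frame_reflect adj_simps matrix_transpose_mul matrix_mul_assoc)
qed

text \<open>On the unit circle \<open>inverse l\<close> is \<open>cnj l\<close>, so the exponent of
  the frame splits into the oscillation \<open>\<i> * r * x\<close> and the growth
  \<open>- \<mu> * t\<close>.\<close>

lemma vacuum_projector_nth:
  fixes r \<mu> m :: real
  assumes m: "m \<noteq> 0" and l: "l = (complex_of_real r + \<i> * complex_of_real \<mu>) / complex_of_real m" and cm: "cmod l = 1"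
  shows "vacuum_projector m l x t $ 1 $ 1 = complex_of_real (exp (- (2 * \<mu> * t))) / 2"
    "vacuum_projector m l x t $ 1 $ 2 = exp (- (2 * \<i> * r * x)) / 2"
    "vacuum_projector m l x t $ 2 $ 1 = exp (2 * \<i> * r * x) / 2"
    "vacuum_projector m l x t $ 2 $ 2 = complex_of_real (exp (2 * \<mu> * t)) / 2"
proof -
  have "l * cnj l = 1" using cm complex_norm_square[of l] by simp
  then have il: "inverse l = cnj l" by (rule inverse_unique)
  define w where "w = \<i> * r * x - \<mu> * t"
  have w: "\<i> * m * (l * complex_of_real ((x + t) / 2) + inverse l * complex_of_real ((x - t) / 2)) = w"
    unfolding il using m by (simp add: l w_def field_simps)
  have V: "vacuum_frame m l ((x + t) / 2) ((x - t) / 2) = diag2 (exp w) (exp (- w))"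
    unfolding vacuum_frame_def Let_def w ..
  have cw: "cnj w = - (\<i> * r * x) - \<mu> * t" by (simp add: w_def)
  have P: "vacuum_projector m l x t $ 1 $ 1 = exp (cnj w + w) / 2" "vacuum_projector m l x t $ 1 $ 2 = exp (cnj w - w) / 2"
    "vacuum_projector m l x t $ 2 $ 1 = exp (- cnj w + w) / 2" "vacuum_projector m l x t $ 2 $ 2 = exp (- cnj w - w) / 2"
    unfolding vacuum_projector_def V diag2_simps
    by (simp_all add: mult_nth exp_cnj exp_add exp_diff exp_minus field_simps)
  show "vacuum_projector m l x t $ 1 $ 1 = complex_of_real (exp (- (2 * \<mu> * t))) / 2"
    "vacuum_projector m l x t $ 1 $ 2 = exp (- (2 * \<i> * r * x)) / 2"
    "vacuum_projector m l x t $ 2 $ 1 = exp (2 * \<i> * r * x) / 2"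
    "vacuum_projector m l x t $ 2 $ 2 = complex_of_real (exp (2 * \<mu> * t)) / 2"
    unfolding P cw by (simp_all add: w_def exp_of_real[symmetric] mult.assoc)
qed

lemma exp_tendsto_zero:
  assumes "c > 0"
  shows "((\<lambda>p. exp (- (c * snd p))) \<longlongrightarrow> (0::real)) (filtercomap snd at_top)"
    "((\<lambda>p. exp (c * snd p)) \<longlongrightarrow> (0::real)) (filtercomap snd at_bot)"
proof -
  have "((\<lambda>t. exp (- (c * t))) \<longlongrightarrow> (0::real)) at_top" "((\<lambda>t. exp (c * t)) \<longlongrightarrow> (0::real)) at_bot"
    using assms
    by (auto intro!: filterlim_compose[OF exp_at_bot] filterlim_tendsto_pos_mult_at_bot[OF tendsto_const _ filterlim_ident]
        filterlim_compose[OF filterlim_uminus_at_bot_at_top] filterlim_tendsto_pos_mult_at_top[OF tendsto_const _ filterlim_ident])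
  then show "((\<lambda>p. exp (- (c * snd p))) \<longlongrightarrow> (0::real)) (filtercomap snd at_top)"
    "((\<lambda>p. exp (c * snd p)) \<longlongrightarrow> (0::real)) (filtercomap snd at_bot)"
    by (auto intro: filterlim_compose[OF _ filterlim_filtercomap])
qed

text \<open>The scalar makes the dominant diagonal entry equal to 1. The off-diagonal entries then
  have modulus exp(-2 \<mu> |t|) and the other diagonal entry is exp(-4 \<mu> |t|), with bounds
  independent of x.\<close>

lemma vacuum_projector_tendsto:
  fixes r \<mu> m :: real
  assumes m: "m \<noteq> 0" and l: "l = (complex_of_real r + \<i> * complex_of_real \<mu>) / complex_of_real m" and cm: "cmod l = 1"
    and \<mu>: "\<mu> > 0"
  shows "((\<lambda>p. complex_of_real (2 * exp (- (2 * \<mu> * snd p))) \<cdot>\<^sub>M vacuum_projector m l (fst p) (snd p)) \<longlongrightarrow> diag2 0 1) (filtercomap snd at_top)"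
    "((\<lambda>p. complex_of_real (2 * exp (2 * \<mu> * snd p)) \<cdot>\<^sub>M vacuum_projector m l (fst p) (snd p)) \<longlongrightarrow> diag2 1 0) (filtercomap snd at_bot)"
proof -
  note N = vacuum_projector_nth[OF m l cm]
  have n: "cmod (exp (2 * \<i> * r * x)) = 1" "cmod (exp (- (2 * \<i> * r * x))) = 1" for x :: real
    by (simp_all add: norm_exp_eq_Re)
  have z: "((\<lambda>p. complex_of_real (f p) * exp (2 * \<i> * r * complex_of_real (fst p))) \<longlongrightarrow> 0) F"
    "((\<lambda>p. complex_of_real (f p) * exp (- (2 * \<i> * r * complex_of_real (fst p)))) \<longlongrightarrow> 0) F"
    if "(f \<longlongrightarrow> 0) F" for f and F :: "(real \<times> real) filter"
    by (rule tendsto_norm_zero_cancel, use tendsto_rabs_zero[OF that] n in \<open>simp add: norm_mult\<close>)+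
  have inv: "complex_of_real (exp (- y)) * complex_of_real (exp y) = 1"
    "complex_of_real (exp y) * complex_of_real (exp (- y)) = 1" for y
    by (simp_all add: of_real_mult[symmetric] exp_add[symmetric] del: of_real_mult)
  have sq: "((\<lambda>p. complex_of_real (f p) * complex_of_real (f p)) \<longlongrightarrow> 0) F"
    if "(f \<longlongrightarrow> 0) F" for f and F :: "(real \<times> real) filter"
    using tendsto_mult[OF tendsto_of_real[OF that] tendsto_of_real[OF that]] by simp
  have top: "((\<lambda>p. exp (- (2 * \<mu> * snd p))) \<longlongrightarrow> 0) (filtercomap snd at_top)"
    and bot: "((\<lambda>p. exp (2 * \<mu> * snd p)) \<longlongrightarrow> 0) (filtercomap snd at_bot)"
    using exp_tendsto_zero[of "2 * \<mu>"] \<mu> by auto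
  show "((\<lambda>p. complex_of_real (2 * exp (- (2 * \<mu> * snd p))) \<cdot>\<^sub>M vacuum_projector m l (fst p) (snd p)) \<longlongrightarrow> diag2 0 1) (filtercomap snd at_top)"
    by (rule tendsto_cmat)
       (use sq[OF top] z[OF top] in \<open>simp_all add: N inv\<close>)
  show "((\<lambda>p. complex_of_real (2 * exp (2 * \<mu> * snd p)) \<cdot>\<^sub>M vacuum_projector m l (fst p) (snd p)) \<longlongrightarrow> diag2 1 0) (filtercomap snd at_bot)"
    by (rule tendsto_cmat)
       (use sq[OF bot] z[OF bot] in \<open>simp_all add: N inv\<close>)
qed

lemma exp_half_integer_period:
  fixes y :: real
  assumes "2 * y \<in> \<int>"
  shows "exp (2 * \<i> * y * complex_of_real (x + 2 * pi)) = exp (2 * \<i> * y * complex_of_real x)"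
    "exp (- (2 * \<i> * y * complex_of_real (x + 2 * pi))) = exp (- (2 * \<i> * y * complex_of_real x))"
proof -
  have "exp (complex_of_real (2 * (2 * y) * pi) * \<i>) = 1" using assms by (rule exp_integer_2pi)
  moreover have "2 * \<i> * y * complex_of_real (x + 2 * pi) = 2 * \<i> * y * complex_of_real x + complex_of_real (2 * (2 * y) * pi) * \<i>"
    by (simp add: algebra_simps)
  ultimately show *: "exp (2 * \<i> * y * complex_of_real (x + 2 * pi)) = exp (2 * \<i> * y * complex_of_real x)"
    by (simp only: exp_add mult_1_right)
  show "exp (- (2 * \<i> * y * complex_of_real (x + 2 * pi))) = exp (- (2 * \<i> * y * complex_of_real x))"
    unfolding exp_minus * ..
qed

text \<open>Only the product of the two outer diagonal factors has period \<open>2 * pi\<close>; each of them may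
  change sign.\<close>

lemma diag2_conjugate_period:
  fixes m :: real and M :: cmat
  assumes "2 * m \<in> \<int>"
  defines "D \<equiv> \<lambda>x::real. diag2 (exp (- (\<i> * m * x))) (exp (\<i> * m * x))"
  shows "D (x + 2 * pi) ** M ** D (x + 2 * pi) = D x ** M ** D x"
proof -
  define \<epsilon> where "\<epsilon> = exp (2 * pi * \<i> * m)"
  have e2: "\<epsilon> * \<epsilon> = 1"
  proof -
    have "exp (complex_of_real (2 * (2 * m) * pi) * \<i>) = 1" using assms(1) by (rule exp_integer_2pi)
    then show ?thesis by (simp add: \<epsilon>_def exp_add[symmetric] algebra_simps)
  qed
  \<comment> \<open>Being its own inverse, the sign is the same for both diagonal entries, so the
    whole matrix is multiplied by it.\<close>
  then have "inverse \<epsilon> = \<epsilon>" by (rule inverse_unique)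
  then have e': "exp (- (2 * pi * \<i> * m)) = \<epsilon>" by (simp add: \<epsilon>_def exp_minus)
  have "\<i> * m * complex_of_real (x + 2 * pi) = 2 * pi * \<i> * m + \<i> * m * x"
    "- (\<i> * m * complex_of_real (x + 2 * pi)) = - (2 * pi * \<i> * m) + - (\<i> * m * x)"
    by (simp_all add: algebra_simps)
  then have "D (x + 2 * pi) = \<epsilon> \<cdot>\<^sub>M D x"
    by (simp only: D_def exp_add e' \<epsilon>_def[symmetric] diag2_simps)
  then show ?thesis by (simp add: mult_simps mscale_simps e2)
qed

section \<open>Symmetry, periodicity and limits of the dressed vacuum\<close>

theorem theorem7p5:
  fixes k :: nat and m :: real and r \<mu> \<theta> :: "nat \<Rightarrow> real" and z :: "nat \<Rightarrow> complex"
    and a \<pi> :: cmat and s0 s :: "real \<Rightarrow> real \<Rightarrow> cmat"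
  assumes m: "2 * m \<in> \<int>"
    and a: "a = diag2 (\<i> * complex_of_real m) (- \<i> * complex_of_real m)"
    and s0: "s0 = (\<lambda>x t. mat_exp ((- 2 * x) *\<^sub>R a))"
    and \<pi>: "\<pi> = herm_proj (vec.span {vector [1, 1]})"
    and r: "\<And>j. j \<in> {1..2 * k} \<Longrightarrow> 2 * r j \<in> \<int> \<and> \<bar>r j\<bar> < m"
    and \<mu>: "\<And>j. j \<in> {1..2 * k} \<Longrightarrow> \<mu> j = sqrt (m\<^sup>2 - (r j)\<^sup>2)"
    and z: "\<And>j. j \<in> {1..2 * k} \<Longrightarrow>
      z j = exp (\<i> * complex_of_real (\<theta> j)) \<and>
      z j = (complex_of_real (r j) + \<i> * complex_of_real (\<mu> j)) / complex_of_real m"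
    and pairs: "\<And>j. j \<in> {1..k} \<Longrightarrow> z (2 * j) = - cnj (z (2 * j - 1))"
    and distinct: "inj_on z {1..2 * k}"
    and s: "s = flow_wave_map (backlund_seq z (\<lambda>_. \<pi>) (vacuum a) (2 * k))"
  shows "homoclinic_wave_map s \<and> (\<forall>x t. s x t \<in> S2) \<and> soliton_wave_map (vacuum a) s0 (2 * k) s"
proof -
  \<comment> \<open>Positivity is tied to an index: for \<open>k = 0\<close> no hypothesis fixes the
    sign of \<open>m\<close>.\<close>
  have mpos: "m > 0" if "j \<in> {1..2 * k}" for j using r[OF that] by linarith
  have \<mu>pos: "\<mu> j > 0" if "j \<in> {1..2 * k}" for j
  proof -
    have "(r j)\<^sup>2 < m\<^sup>2" using r[OF that] mpos[OF that] by (metis abs_le_square_iff abs_of_pos not_le)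
    then show ?thesis using \<mu>[OF that] by simp
  qed
  have zj: "cmod (z j) = 1" and zj': "z j = (complex_of_real (r j) + \<i> * complex_of_real (\<mu> j)) / complex_of_real m"
    if "j \<in> {1..2 * k}" for j
  proof -
    have "z j = exp (\<i> * complex_of_real (\<theta> j))" using z[OF that] by blast
    then show "cmod (z j) = 1" by (simp add: norm_exp_eq_Re)
    show "z j = (complex_of_real (r j) + \<i> * complex_of_real (\<mu> j)) / complex_of_real m" using z[OF that] by blast
  qed
  have Im_z: "0 < Im (z j)" if "j \<in> {1..2 * k}" for j
    using zj'[OF that] mpos[OF that] \<mu>pos[OF that] by simp
  interpret symmetric_pole_sequence z k
    by unfold_locales (use Im_z distinct pairs in auto)
  note p = rank_one_half_ones
  note pD = rank_one_projectionD[OF p]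
  have \<pi>': "\<pi> = half_ones" unfolding \<pi> by (rule herm_proj_diagonal_line)
  have vac: "vacuum a = ((\<lambda>_ _. a), (\<lambda>_ _. 0), (\<lambda>_ _. a))" by (simp add: vacuum_def)
  note F0 = flow_frame_vacuum[OF a]
  let ?F = "soliton_frame z half_ones (vacuum_frame m) (2 * k)"
  obtain u v where S: "backlund_seq z (\<lambda>_. \<pi>) (vacuum a) (2 * k) = ((\<lambda>_ _. a), u, v)"
    and F: "flow_frame a u v ?F (poles z (2 * k))"
    using flow_frame_soliton[OF F0 p order_refl] unfolding vac \<pi>' by blast
  have good: "1 \<notin> poles z (2 * k)" "- 1 \<notin> poles z (2 * k)" by (simp_all add: real_not_pole)
  have wave: "wave_map s" unfolding s S by (rule wave_map_flow_wave_map[OF F good])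

  \<comment> \<open>Factorisation of the wave map\<close>
  define P where "P x t j = vacuum_projector m (z j) x t" for x t j
  define H where "H x t l = right_factor z (P x t) (2 * k) l" for x t l
  define D where "D x = diag2 (exp (- (\<i> * m * x))) (exp (\<i> * m * x))" for x :: real
  define C where "C = simple_factor half_ones ((- 1) ^ k)"
  have adjC: "adj C = C" by (simp add: C_def simple_factor_adj pD)
  have prods: "(\<Prod>i\<in>{1..2 * k}. blaschke (z i) 1) = (- 1) ^ k" "(\<Prod>i\<in>{1..2 * k}. blaschke (z i) (- 1)) = (- 1) ^ k"
    using prod_blaschke_unimodular[OF zj, of 1 k] prod_blaschke_unimodular[OF zj, of "- 1" k] by auto
  have frame: "?F l ((x + t) / 2) ((x - t) / 2) = simple_factor half_ones (\<Prod>i\<in>{1..2 * k}. blaschke (z i) l) **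
      vacuum_frame m l ((x + t) / 2) ((x - t) / 2) ** H x t l" for l x t
    unfolding soliton_frame_factor[OF p] H_def P_def vacuum_projector_def ..
  \<comment> \<open>The constant left factors at 1 and -1 coincide because both Blaschke products
    are \<open>(- 1) ^ k\<close>; this real scalar also makes \<open>C\<close> Hermitian.\<close>
  have s_eq: "s x t = C ** D x ** (H x t (- 1) ** adj (H x t 1)) ** D x ** C" for x t
    unfolding s S flow_wave_map_eq[OF F good] frame prods C_def[symmetric] adj_simps vacuum_frame_one adjC D_def[symmetric]
    by (simp only: matrix_mul_assoc)

  \<comment> \<open>The image lies in the sphere of symmetric matrices\<close>
  have PE: "\<exists>E F. F ** E = mat 1 \<and> P x t j = adj E ** half_ones ** E" for x t j
    unfolding P_def vacuum_projector_def using vacuum_frame_unitary by blast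
  have H_sym: "transpose (H x t (- 1)) ** H x t 1 = mat 1" for x t
    unfolding H_def
  proof (rule right_factor_symmetric[OF p PE _ order_refl good(1)])
    fix j assume "j \<in> {1..k}"
    then show "P x t (2 * j) = transpose (P x t (2 * j - 1))"
      using pairs by (simp add: P_def vacuum_projector_reflect)
  qed
  have "adj (H x t 1) ** H x t 1 = mat 1" for x t
    using right_factor_unitary(1)[where P = "P x t", OF p PE order_refl good(1)] by (simp add: H_def)
  \<comment> \<open>Both matrices are left inverses of the right factor at 1. Thus
    \<open>s x t\<close> is \<open>A ** transpose A\<close> with
    \<open>A = C ** D x ** H x t (- 1)\<close>.\<close>
  then have adjH: "adj (H x t 1) = transpose (H x t (- 1))" for x t
    using H_sym[of x t] by (metis matrix_left_right_inverse matrix_mul_assoc matrix_mul_lid matrix_mul_rid)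
  have s_S2: "s x t \<in> S2" for x t
  proof -
    have "transpose C = C" "transpose (D x) = D x"
      by (simp_all add: C_def D_def diag2_simps) (simp add: simple_factor_def cmat_eq_iff mat_nth)
    then have "transpose (s x t) = s x t"
      by (simp add: s_eq adjH matrix_transpose_mul matrix_mul_assoc)
    then show ?thesis using wave by (simp add: S2_def wave_map_def)
  qed

  \<comment> \<open>Periodicity in x\<close>
  have periodic: "s (x + 2 * pi) t = s x t" for x t
  proof -
    have "P (x + 2 * pi) t j = P x t j" if "j \<in> {1..2 * k}" for j
      using mpos[OF that] r[OF that] unfolding P_def cmat_eq_iff
      by (simp add: vacuum_projector_nth[OF _ zj'[OF that] zj[OF that]] exp_half_integer_period del: of_real_add)
    then have "right_factor z (P (x + 2 * pi) t) n l = right_factor z (P x t) n l" if "n \<le> 2 * k" for n l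
      using that by (induction n arbitrary: l) simp_all
    then have "H (x + 2 * pi) t l = H x t l" for l by (simp add: H_def)
    moreover have "s x t = C ** (D x ** (H x t (- 1) ** adj (H x t 1)) ** D x) ** C" for x
      by (simp only: s_eq matrix_mul_assoc)
    ultimately show ?thesis
      using diag2_conjugate_period[OF m, of x] by (simp only: D_def)
  qed

  \<comment> \<open>Limits as t tends to plus and minus infinity\<close>
  have H_lim: "((\<lambda>p. H (fst p) (snd p) (- 1) ** adj (H (fst p) (snd p) 1)) \<longlongrightarrow> mat 1) F"
    if e: "rank_one_projection e" and c: "\<And>p j. c p j \<noteq> 0"
      and lim: "\<And>j. j \<in> {1..2 * k} \<Longrightarrow> ((\<lambda>p. c p j \<cdot>\<^sub>M P (fst p) (snd p) j) \<longlongrightarrow> e) F"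
    for e c and F :: "(real \<times> real) filter"
  proof -
    note eD = rank_one_projectionD[OF e]
    have "(\<Prod>i\<in>{1..2 * k}. blaschke (cnj (z i)) l) = cnj (\<Prod>i\<in>{1..2 * k}. blaschke (z i) (cnj l))" for l
      by (simp add: blaschke_cnj)
    from this[of 1] this[of "- 1"] have pr: "(\<Prod>i\<in>{1..2 * k}. blaschke (cnj (z i)) 1) = (- 1) ^ k" "(\<Prod>i\<in>{1..2 * k}. blaschke (cnj (z i)) (- 1)) = (- 1) ^ k"
      unfolding complex_cnj_minus complex_cnj_one prods by simp_all
    have "((\<lambda>p. H (fst p) (snd p) l) \<longlongrightarrow> simple_factor e (\<Prod>i\<in>{1..2 * k}. blaschke (cnj (z i)) l)) F" for l
      unfolding H_def by (rule right_factor_tendsto_normalized[OF e c lim])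
    \<comment> \<open>Both right factors tend to the same simple factor with scalar
      \<open>(- 1) ^ k\<close>, whose square is 1. The limit of the product is independent of
      \<open>e\<close>, so the two ends of time agree.\<close>
    from bounded_bilinear.tendsto[OF bounded_bilinear_matrix_mult this[of "- 1"] bounded_linear.tendsto[OF bounded_linear_adj this[of 1]]]
    show ?thesis
      unfolding pr by (simp add: simple_factor_adj simple_factor_mult eD power_mult_distrib[symmetric])
  qed
  have lim_top: "((\<lambda>p. H (fst p) (snd p) (- 1) ** adj (H (fst p) (snd p) 1)) \<longlongrightarrow> mat 1) (filtercomap snd at_top)"
  proof (rule H_lim)
    show "rank_one_projection (diag2 0 1)"
      by (simp add: rank_one_projection_def hermitian_projection_def diag2_simps trace_2)
    show "complex_of_real (2 * exp (- (2 * \<mu> j * snd p))) \<noteq> 0" for p :: "real \<times> real" and j by simp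
    show "((\<lambda>p. complex_of_real (2 * exp (- (2 * \<mu> j * snd p))) \<cdot>\<^sub>M P (fst p) (snd p) j) \<longlongrightarrow> diag2 0 1) (filtercomap snd at_top)"
      if "j \<in> {1..2 * k}" for j
      using vacuum_projector_tendsto(1)[OF _ zj'[OF that] zj[OF that] \<mu>pos[OF that]] mpos[OF that] by (simp add: P_def)
  qed
  have lim_bot: "((\<lambda>p. H (fst p) (snd p) (- 1) ** adj (H (fst p) (snd p) 1)) \<longlongrightarrow> mat 1) (filtercomap snd at_bot)"
  proof (rule H_lim)
    show "rank_one_projection (diag2 1 0)"
      by (simp add: rank_one_projection_def hermitian_projection_def diag2_simps trace_2)
    show "complex_of_real (2 * exp (2 * \<mu> j * snd p)) \<noteq> 0" for p :: "real \<times> real" and j by simp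
    show "((\<lambda>p. complex_of_real (2 * exp (2 * \<mu> j * snd p)) \<cdot>\<^sub>M P (fst p) (snd p) j) \<longlongrightarrow> diag2 1 0) (filtercomap snd at_bot)"
      if "j \<in> {1..2 * k}" for j
      using vacuum_projector_tendsto(2)[OF _ zj'[OF that] zj[OF that] \<mu>pos[OF that]] mpos[OF that] by (simp add: P_def)
  qed
  obtain K where K: "norm (D x) \<le> K" for x
  proof -
    obtain K1 where K1: "\<And>c. norm (diag2 c 0) \<le> norm c * K1"
      using bounded_linear.bounded[OF bounded_linear_diag2(1)] by blast
    obtain K2 where K2: "\<And>c. norm (diag2 0 c) \<le> norm c * K2"
      using bounded_linear.bounded[OF bounded_linear_diag2(2)] by blast
    have "norm (D x) \<le> K1 + K2" for x
    proof -
      have "norm (D x) \<le> norm (diag2 (exp (- (\<i> * m * x))) 0) + norm (diag2 0 (exp (\<i> * m * x)))"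
        unfolding D_def by (subst diag2_split) (rule norm_triangle_ineq)
      also have "\<dots> \<le> K1 + K2"
        using K1[of "exp (- (\<i> * m * x))"] K2[of "exp (\<i> * m * x)"] by (simp add: norm_exp_eq_Re)
      finally show ?thesis .
    qed
    then show thesis by (rule that)
  qed
  have homoclinic: "homoclinic_wave_map s"
    unfolding homoclinic_wave_map_def periodic_wave_map_def
  proof (intro conjI exI allI)
    show "wave_map s" by (rule wave)
    show "s (x + 2 * pi) t = s x t" for x t by (rule periodic)
    show "uniform_limit UNIV (\<lambda>t x. s x t) (\<lambda>x. C ** D x ** D x ** C) at_top"
      unfolding s_eq by (rule uniform_limit_conjugate[OF lim_top K])
    show "uniform_limit UNIV (\<lambda>t x. s x t) (\<lambda>x. C ** D x ** D x ** C) at_bot"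
      unfolding s_eq by (rule uniform_limit_conjugate[OF lim_bot K])
  qed

  \<comment> \<open>The seed and the soliton property\<close>
  have "s0 x t = flow_wave_map (vacuum a) x t" for x t
  proof -
    have "flow_wave_map (vacuum a) x t = D x ** D x"
      unfolding vac by (subst flow_wave_map_eq[OF F0]) (simp_all add: vacuum_frame_one D_def)
    also have "\<dots> = mat_exp ((- 2 * x) *\<^sub>R a)"
      unfolding a diag2_simps mat_exp_diag2 D_def
      by (simp add: exp_add[symmetric] scaleR_conv_of_real algebra_simps)
    finally show ?thesis by (simp add: s0)
  qed
  then have c0: "corresponds (vacuum a) s0"
    using F0 unfolding corresponds_def vac flow_frame_def by blast
  have "corresponds (backlund_seq z (\<lambda>_. \<pi>) (vacuum a) (2 * k)) s"
    using F unfolding corresponds_def S flow_frame_def s by blast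
  moreover have "z j \<notin> \<real> \<and> hermitian_projection \<pi>" if "j \<in> {1..2 * k}" for j
    using Im_z[OF that] p by (auto simp: \<pi>' rank_one_projection_def complex_is_Real_iff)
  ultimately have "soliton_wave_map (vacuum a) s0 (2 * k) s"
    unfolding soliton_wave_map_def using c0 wave
    by (intro conjI exI[of _ z] exI[of _ "\<lambda>_. \<pi>"] ballI) simp_all
  then show ?thesis using homoclinic s_S2 by blast
qed

end
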